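(* Every $4$-dimensional real Lie algebra is isomorphic to a D-extension $\mathfrak{g}_D$ of one of the following unimodular $3$-dimensional real Lie algebras $\mathfrak{g}=\mathfrak{g}_f$ by one of the indicated derivations $D$ (written as matrices in the basis $e_1,e_2,e_3$, acting on column vectors), where $\alpha,\beta,\gamma,\delta,\epsilon,\varepsilon,\zeta\in\mathbb{R}$ are arbitrary constants: - (1) $f=0$: $D=0$, $\begin{pmatrix}0&1&0\\0&0&1\\0&0&0\end{pmatrix}$, $\begin{pmatrix}1&0&0\\0&0&1\\0&0&0\end{pmatrix}$, $\begin{pmatrix}1&1&0\\0&1&1\\0&0&1\end{pmatrix}$, $\begin{pmatrix}1&1&0\\0&1&0\\0&0&\alpha\end{pmatrix}$, $\begin{pmatrix}1&0&0\\0&\beta&0\\0&0&\gamma\end{pmatrix}$, $\begin{pmatrix}\delta&1&0\\-1&\delta&0\\0&0&\epsilon\end{pmatrix}$. - (2) $f=x^2+y^2+z^2$: $D=0$. - (3) $f=x^2+y^2-z^2$: $D=0$. - (4) $f=x^2+y^2$: $D=0$, $\begin{pmatrix}1&0&0\\0&1&0\\0&0&0\end{pmatrix}$. - (5) $f=x^2-y^2$: $D=0$, $\begin{pmatrix}1&0&0\\0&1&0\\0&0&0\end{pmatrix}$. - (6) $f=x^2$: $D=0$, $\begin{pmatrix}0&0&0\\0&1&0\\0&0&-1\end{pmatrix}$, $\begin{pmatrix}0&0&0\\0&0&1\\0&-1&0\end{pmatrix}$, $\begin{pmatrix}2&0&0\\0&1&1\\0&0&1\end{pmatrix}$, $\begin{pmatrix}2&0&0\\0&1&\varepsilon\\0&-\varepsilon&1\end{pmatrix}$,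 $\begin{pmatrix}1&0&0\\0&\zeta&0\\0&0&1-\zeta\end{pmatrix}$.
   Context: For a homogeneous quadratic function $f$ of $(x,y,z)$ on $\mathbb{R}^3$, $\mathfrak{g}_f$ is the (unimodular) Lie algebra with basis $e_1,e_2,e_3$ corresponding to the linear Poisson structure $\pi_f=\frac{\partial f}{\partial x}\partial_y\wedge\partial_z+\frac{\partial f}{\partial y}\partial_z\wedge\partial_x+\frac{\partial f}{\partial z}\partial_x\wedge\partial_y$ on $\mathfrak{g}_f^*\cong\mathbb{R}^3$, where $e_1,e_2,e_3$ correspond to the linear coordinate functions $x,y,z$. Explicitly, for $f=a_1x^2+a_2y^2+a_3z^2$, $$[e_1,e_2]=2a_3e_3,\qquad [e_2,e_3]=2a_1e_1,\qquad [e_3,e_1]=2a_2e_2.$$ D-extension: for a derivation $D$ of $\mathfrak{g}$, $\mathfrak{g}_D=\mathfrak{g}\oplus\mathbb{R}e$ as a vector space, with $\mathfrak{g}$ a subalgebra with its given bracket and $[\xi,e]=D(\xi)$ for $\xi\in\mathfrak{g}$. *)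

theory Defs
  imports "HOL-Analysis.Analysis"
begin

section \<open>Real Lie algebras\<close>

definition lie_algebra :: "('a::real_vector \<Rightarrow> 'a \<Rightarrow> 'a) \<Rightarrow> bool" where
  "lie_algebra br \<longleftrightarrow>
     bilinear br \<and> (\<forall>x. br x x = 0) \<and>
     (\<forall>x y z. br x (br y z) + br y (br z x) + br z (br x y) = 0)"

definition derivation :: "('a::real_vector \<Rightarrow> 'a \<Rightarrow> 'a) \<Rightarrow> ('a \<Rightarrow> 'a) \<Rightarrow> bool" where
  "derivation br D \<longleftrightarrow> linear D \<and> (\<forall>x y. D (br x y) = br (D x) y + br x (D y))"

definition lie_isomorphic ::
    "('a::real_vector \<Rightarrow> 'a \<Rightarrow> 'a) \<Rightarrow> ('b::real_vector \<Rightarrow> 'b \<Rightarrow> 'b) \<Rightarrow> bool" where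
  "lie_isomorphic br br' \<longleftrightarrow>
     (\<exists>\<phi>. linear \<phi> \<and> bij \<phi> \<and> (\<forall>x y. \<phi> (br x y) = br' (\<phi> x) (\<phi> y)))"

definition unimodular :: "(real^'n \<Rightarrow> real^'n \<Rightarrow> real^'n) \<Rightarrow> bool" where
  "unimodular br \<longleftrightarrow> (\<forall>x. trace (matrix (br x)) = 0)"

text \<open>The pair \<open>(\<xi>, s)\<close> stands for \<open>\<xi> + s e\<close>; the formula is the bilinear alternating
  extension of the bracket of the subalgebra and of \<open>[\<xi>, e] = D \<xi>\<close>.\<close>

definition D_extension ::
    "('a::real_vector \<Rightarrow> 'a \<Rightarrow> 'a) \<Rightarrow> ('a \<Rightarrow> 'a) \<Rightarrow> 'a \<times> real \<Rightarrow> 'a \<times> real \<Rightarrow> 'a \<times> real" where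
  "D_extension br D = (\<lambda>(\<xi>, s) (\<eta>, t). (br \<xi> \<eta> + t *\<^sub>R D \<xi> - s *\<^sub>R D \<eta>, 0))"

lemma lie_algebra_D_extension:
  assumes "lie_algebra br" and "derivation br D"
  shows "lie_algebra (D_extension br D)"
proof -
  have bil: "bilinear br" and alt: "\<And>x. br x x = 0"
    and jac: "\<And>x y z. br x (br y z) + br y (br z x) + br z (br x y) = 0"
    using assms(1) by (auto simp: lie_algebra_def)
  have lin: "linear D" and der: "\<And>x y. D (br x y) = br (D x) y + br x (D y)"
    using assms(2) by (auto simp: derivation_def)
  note b = bilinear_ladd[OF bil] bilinear_radd[OF bil] bilinear_lmul[OF bil] bilinear_rmul[OF bil]
    bilinear_lsub[OF bil] bilinear_rsub[OF bil]
  note l = linear_add[OF lin] linear_diff[OF lin] linear_scale[OF lin]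
  have anti: "br x y = - br y x" for x y
  proof -
    have "br (x + y) (x + y) = br x x + br y y + (br x y + br y x)"
      by (simp only: b) (simp only: ac_simps)
    then show ?thesis
      by (simp add: alt eq_neg_iff_add_eq_0)
  qed
  have "bilinear (D_extension br D)"
    unfolding bilinear_def
    by (auto intro!: linearI simp: D_extension_def b l algebra_simps split: prod.splits)
  moreover have "D_extension br D x x = 0" for x
    by (cases x) (simp add: D_extension_def alt zero_prod_def)
  moreover have "D_extension br D x (D_extension br D y z) + D_extension br D y (D_extension br D z x)
      + D_extension br D z (D_extension br D x y) = 0" for x y z
  proof -
    obtain a r where x: "x = (a, r)" by (cases x)
    obtain c s where y: "y = (c, s)" by (cases y)
    obtain d t where z: "z = (d, t)" by (cases z)
    have "br d (br a c) = - br a (br c d) - br c (br d a)"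
      using jac[of a c d] by (simp add: algebra_simps eq_neg_iff_add_eq_0)
    moreover have "br (D a) c = - br c (D a)" "br (D c) d = - br d (D c)" "br (D d) a = - br a (D d)"
      using anti by blast+
    ultimately show ?thesis
      by (simp add: x y z D_extension_def b l der zero_prod_def algebra_simps)
  qed
  ultimately show ?thesis
    by (simp add: lie_algebra_def)
qed


section \<open>The Lie algebra of a quadratic function\<close>

definition pderiv_at :: "3 \<Rightarrow> (real^3 \<Rightarrow> real) \<Rightarrow> real^3 \<Rightarrow> real" where
  "pderiv_at i f p = frechet_derivative f (at p) (axis i 1)"

text \<open>\<open>poisson f g h\<close> is the function \<open>\<pi>\<^sub>f(dg, dh)\<close>.\<close>

definition poisson ::
    "(real^3 \<Rightarrow> real) \<Rightarrow> (real^3 \<Rightarrow> real) \<Rightarrow> (real^3 \<Rightarrow> real) \<Rightarrow> real^3 \<Rightarrow> real" where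
  "poisson f g h p =
     pderiv_at 1 f p * (pderiv_at 2 g p * pderiv_at 3 h p - pderiv_at 3 g p * pderiv_at 2 h p) +
     pderiv_at 2 f p * (pderiv_at 3 g p * pderiv_at 1 h p - pderiv_at 1 g p * pderiv_at 3 h p) +
     pderiv_at 3 f p * (pderiv_at 1 g p * pderiv_at 2 h p - pderiv_at 2 g p * pderiv_at 1 h p)"

text \<open>The vector \<open>\<xi> = \<xi>\<^sub>1 e\<^sub>1 + \<xi>\<^sub>2 e\<^sub>2 + \<xi>\<^sub>3 e\<^sub>3\<close> stands for the linear function
  \<open>\<xi>\<^sub>1 x + \<xi>\<^sub>2 y + \<xi>\<^sub>3 z\<close>. For homogeneous quadratic \<open>f\<close> the Poisson bracket of two linear
  functions is again a linear function, represented by the bracket of the two vectors.\<close>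

definition lie_of :: "(real^3 \<Rightarrow> real) \<Rightarrow> real^3 \<Rightarrow> real^3 \<Rightarrow> real^3" where
  "lie_of f \<xi> \<eta> = (THE \<zeta>. \<forall>p. \<zeta> \<bullet> p = poisson f (\<lambda>p. \<xi> \<bullet> p) (\<lambda>p. \<eta> \<bullet> p) p)"

lemma pderiv_at_linear: "pderiv_at i (\<lambda>p. \<xi> \<bullet> p) p = \<xi> $ i"
proof -
  have "((\<lambda>p. \<xi> \<bullet> p) has_derivative (\<lambda>p. \<xi> \<bullet> p)) (at p)"
    by (auto intro!: derivative_eq_intros)
  then have "frechet_derivative (\<lambda>p. \<xi> \<bullet> p) (at p) = (\<lambda>p. \<xi> \<bullet> p)"
    by (rule frechet_derivative_at[symmetric])
  then show ?thesis
    by (simp add: pderiv_at_def inner_axis)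
qed

definition diagonal_form :: "real \<Rightarrow> real \<Rightarrow> real \<Rightarrow> real^3 \<Rightarrow> real" where
  "diagonal_form a1 a2 a3 = (\<lambda>p. a1 * (p $ 1)\<^sup>2 + a2 * (p $ 2)\<^sup>2 + a3 * (p $ 3)\<^sup>2)"

lemma pderiv_at_diagonal_form:
  "pderiv_at i (diagonal_form a1 a2 a3) p = 2 * vector [a1, a2, a3] $ i * p $ i"
proof -
  let ?f' = "\<lambda>h::real^3. 2 * a1 * p $ 1 * h $ 1 + 2 * a2 * p $ 2 * h $ 2 + 2 * a3 * p $ 3 * h $ 3"
  have nth: "((\<lambda>p. p $ k) has_derivative (\<lambda>h. h $ k)) (at p)" for k
    by (rule bounded_linear_imp_has_derivative[OF bounded_linear_vec_nth])
  have "(diagonal_form a1 a2 a3 has_derivative ?f') (at p)"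
    unfolding diagonal_form_def
    by (rule nth derivative_eq_intros refl)+ (simp add: algebra_simps fun_eq_iff)
  then have "frechet_derivative (diagonal_form a1 a2 a3) (at p) = ?f'"
    by (rule frechet_derivative_at[symmetric])
  then show ?thesis
    using exhaust_3[of i] by (elim disjE) (simp_all add: pderiv_at_def axis_def)
qed

lemma lie_of_diagonal_form:
  "lie_of (diagonal_form a1 a2 a3) \<xi> \<eta> =
     vector [2 * a1 * (\<xi> $ 2 * \<eta> $ 3 - \<xi> $ 3 * \<eta> $ 2),
             2 * a2 * (\<xi> $ 3 * \<eta> $ 1 - \<xi> $ 1 * \<eta> $ 3),
             2 * a3 * (\<xi> $ 1 * \<eta> $ 2 - \<xi> $ 2 * \<eta> $ 1)]"
  (is "lie_of ?f \<xi> \<eta> = ?v")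
proof -
  have P: "poisson ?f (\<lambda>p. \<xi> \<bullet> p) (\<lambda>p. \<eta> \<bullet> p) p = ?v \<bullet> p" for p
    by (simp only: poisson_def pderiv_at_linear pderiv_at_diagonal_form)
      (simp add: inner_vec_def sum_3 algebra_simps)
  show ?thesis
    unfolding lie_of_def P
    by (rule the_equality) (simp, metis vector_eq_rdot)
qed

lemma lie_of_diagonal_form_basis:
  "lie_of (diagonal_form a1 a2 a3) (axis 1 1) (axis 2 1) = (2 * a3) *\<^sub>R axis 3 1"
  "lie_of (diagonal_form a1 a2 a3) (axis 2 1) (axis 3 1) = (2 * a1) *\<^sub>R axis 1 1"
  "lie_of (diagonal_form a1 a2 a3) (axis 3 1) (axis 1 1) = (2 * a2) *\<^sub>R axis 2 1"
  by (simp_all add: lie_of_diagonal_form vec_eq_iff forall_3 axis_def)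

lemma lie_algebra_diagonal_form: "lie_algebra (lie_of (diagonal_form a1 a2 a3))"
  unfolding lie_algebra_def bilinear_def
  by (auto intro!: linearI simp: lie_of_diagonal_form vec_eq_iff forall_3 algebra_simps)

lemma unimodular_diagonal_form: "unimodular (lie_of (diagonal_form a1 a2 a3))"
  by (simp add: unimodular_def trace_def matrix_def sum_3 lie_of_diagonal_form axis_def)


section \<open>The list of pairs of a quadratic function and a derivation\<close>

text \<open>Entries are given row by row; \<open>D *v \<xi>\<close> lets \<open>D\<close> act on columns.\<close>

definition mat3 :: "real \<Rightarrow> real \<Rightarrow> real \<Rightarrow> real \<Rightarrow> real \<Rightarrow> real \<Rightarrow> real \<Rightarrow> real \<Rightarrow> real \<Rightarrow> real^3^3" where
  "mat3 a b c  d e f  g h i = vector [vector [a, b, c], vector [d, e, f], vector [g, h, i]]"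

inductive listed :: "(real^3 \<Rightarrow> real) \<Rightarrow> real^3^3 \<Rightarrow> bool" where
  "listed (\<lambda>p. 0) 0"
| "listed (\<lambda>p. 0) (mat3 0 1 0
                         0 0 1
                         0 0 0)"
| "listed (\<lambda>p. 0) (mat3 1 0 0
                         0 0 1
                         0 0 0)"
| "listed (\<lambda>p. 0) (mat3 1 1 0
                         0 1 1
                         0 0 1)"
| "listed (\<lambda>p. 0) (mat3 1 1 0
                         0 1 0
                         0 0 \<alpha>)"
| "listed (\<lambda>p. 0) (mat3 1 0 0
                         0 \<beta> 0
                         0 0 \<gamma>)"
| "listed (\<lambda>p. 0) (mat3 \<delta>     1 0
                         (- 1) \<delta> 0
                         0     0 \<epsilon>)"
| "listed (\<lambda>p. (p $ 1)\<^sup>2 + (p $ 2)\<^sup>2 + (p $ 3)\<^sup>2) 0"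
| "listed (\<lambda>p. (p $ 1)\<^sup>2 + (p $ 2)\<^sup>2 - (p $ 3)\<^sup>2) 0"
| "listed (\<lambda>p. (p $ 1)\<^sup>2 + (p $ 2)\<^sup>2) 0"
| "listed (\<lambda>p. (p $ 1)\<^sup>2 + (p $ 2)\<^sup>2) (mat3 1 0 0
                                             0 1 0
                                             0 0 0)"
| "listed (\<lambda>p. (p $ 1)\<^sup>2 - (p $ 2)\<^sup>2) 0"
| "listed (\<lambda>p. (p $ 1)\<^sup>2 - (p $ 2)\<^sup>2) (mat3 1 0 0
                                             0 1 0
                                             0 0 0)"
| "listed (\<lambda>p. (p $ 1)\<^sup>2) 0"
| "listed (\<lambda>p. (p $ 1)\<^sup>2) (mat3 0 0 0
                                0 1 0
                                0 0 (- 1))"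
| "listed (\<lambda>p. (p $ 1)\<^sup>2) (mat3 0 0    0
                                0 0    1
                                0 (- 1) 0)"
| "listed (\<lambda>p. (p $ 1)\<^sup>2) (mat3 2 0 0
                                0 1 1
                                0 0 1)"
| "listed (\<lambda>p. (p $ 1)\<^sup>2) (mat3 2 0    0
                                0 1    \<kappa>
                                0 (- \<kappa>) 1)"
| "listed (\<lambda>p. (p $ 1)\<^sup>2) (mat3 1 0 0
                                0 \<zeta> 0
                                0 0 (1 - \<zeta>))"

lemma listed_diagonal_form:
  assumes "listed f D"
  obtains a1 a2 a3 where "f = diagonal_form a1 a2 a3" and "derivation (lie_of f) ((*v) D)"
proof -
  have forms: "(\<lambda>p. 0) = diagonal_form 0 0 0"
      "(\<lambda>p. (p $ 1)\<^sup>2 + (p $ 2)\<^sup>2 + (p $ 3)\<^sup>2) = diagonal_form 1 1 1"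
      "(\<lambda>p. (p $ 1)\<^sup>2 + (p $ 2)\<^sup>2 - (p $ 3)\<^sup>2) = diagonal_form 1 1 (- 1)"
      "(\<lambda>p. (p $ 1)\<^sup>2 + (p $ 2)\<^sup>2) = diagonal_form 1 1 0"
      "(\<lambda>p. (p $ 1)\<^sup>2 - (p $ 2)\<^sup>2) = diagonal_form 1 (- 1) 0"
      "(\<lambda>p. (p $ 1)\<^sup>2) = diagonal_form 1 0 0"
    by (auto simp: diagonal_form_def fun_eq_iff)
  have der: "derivation (lie_of (diagonal_form a1 a2 a3)) ((*v) M) \<longleftrightarrow>
      (\<forall>x y. M *v lie_of (diagonal_form a1 a2 a3) x y =
        lie_of (diagonal_form a1 a2 a3) (M *v x) y + lie_of (diagonal_form a1 a2 a3) x (M *v y))"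
    for a1 a2 a3 M by (simp add: derivation_def)
  have "\<exists>a1 a2 a3. f = diagonal_form a1 a2 a3"
    using assms by cases (use forms in blast)+
  moreover have "derivation (lie_of f) ((*v) D)"
    using assms
    by cases (simp_all only: forms der lie_of_diagonal_form, simp_all add: mat3_def vec_eq_iff
        forall_3 matrix_vector_mult_def sum_3 algebra_simps)
  ultimately show ?thesis
    using that by blast
qed

lemma listed_imp:
  assumes "listed f D"
  shows "lie_algebra (lie_of f)" and "unimodular (lie_of f)"
    and "derivation (lie_of f) ((*v) D)" and "lie_algebra (D_extension (lie_of f) ((*v) D))"
  using listed_diagonal_form[OF assms] lie_algebra_diagonal_form unimodular_diagonal_form
    lie_algebra_D_extension by metis+

end

theory Submission
  imports Defs
begin

text \<open>A four-dimensional Lie algebra has a unimodular ideal of codimension one. If \<open>tr \<circ> ad\<close> is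
  nonzero, its kernel is such an ideal. Otherwise any hyperplane containing all brackets will do, and
  there is one because in the unimodular case the two-forms \<open>\<nu> \<circ> br\<close> span an isotropic subspace of
  the six-dimensional space of two-forms, so that \<open>\<nu> \<mapsto> \<nu> \<circ> br\<close> is not injective.
  On the ideal the bracket is \<open>S (x \<times> y)\<close> with \<open>S\<close> symmetric, and a change of basis \<open>P\<close> replaces \<open>S\<close>
  by a multiple of a congruent matrix, so \<open>S\<close> may be taken diagonal with entries in \<open>{0, 2, -2}\<close>.
  Up to inner derivations and scaling, what remains of \<open>D\<close> is a real \<open>2 \<times> 2\<close> or \<open>3 \<times> 3\<close> matrix up to
  conjugation. Two normal forms missing from the list are covered by another choice of the ideal:
  a nilpotent \<open>D\<close> of rank one on the abelian ideal gives the Heisenberg algebra plus a line, and a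
  nonzero nilpotent \<open>D\<close> on the Heisenberg ideal gives the single nilpotent Jordan block on the abelian one.\<close>

unbundle cross3_syntax

section \<open>Isomorphisms\<close>

lemma linear_bij_inv:
  assumes "linear f" "bij f"
  shows "linear (inv f)" "bij (inv f)" "f (inv f y) = y" "inv f (f x) = x"
proof -
  have f: "f (inv f y) = y" "inv f (f x) = x" for x y
    using assms(2) by (simp_all add: bij_is_inj bij_is_surj surj_f_inv_f)
  show "linear (inv f)"
    by (rule linearI) (metis f linear_add[OF assms(1)] linear_scale[OF assms(1)])+
  show "bij (inv f)"
    using assms(2) by (rule bij_imp_bij_inv)
qed (use assms in \<open>simp_all add: bij_is_inj bij_is_surj surj_f_inv_f\<close>)

lemma lie_isomorphic_refl: "lie_isomorphic br br"
  unfolding lie_isomorphic_def by (rule exI[of _ id]) (auto simp: linear_iff)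

lemma lie_isomorphic_sym:
  assumes "lie_isomorphic br br'"
  shows "lie_isomorphic br' br"
proof -
  obtain \<phi> where \<phi>: "linear \<phi>" "bij \<phi>" "\<And>x y. \<phi> (br x y) = br' (\<phi> x) (\<phi> y)"
    using assms by (auto simp: lie_isomorphic_def)
  note i = linear_bij_inv[OF \<phi>(1,2)]
  have "inv \<phi> (br' x y) = br (inv \<phi> x) (inv \<phi> y)" for x y
    using \<phi>(3)[of "inv \<phi> x" "inv \<phi> y"] by (metis i(3,4))
  then show ?thesis
    using i(1,2) by (auto simp: lie_isomorphic_def)
qed

lemma lie_isomorphic_trans:
  assumes "lie_isomorphic br br'" "lie_isomorphic br' br''"
  shows "lie_isomorphic br br''"
proof -
  obtain \<phi> where \<phi>: "linear \<phi>" "bij \<phi>" "\<And>x y. \<phi> (br x y) = br' (\<phi> x) (\<phi> y)"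
    using assms by (auto simp: lie_isomorphic_def)
  obtain \<psi> where \<psi>: "linear \<psi>" "bij \<psi>" "\<And>x y. \<psi> (br' x y) = br'' (\<psi> x) (\<psi> y)"
    using assms by (auto simp: lie_isomorphic_def)
  show ?thesis
    unfolding lie_isomorphic_def
    by (rule exI[of _ "\<psi> \<circ> \<phi>"]) (use \<phi> \<psi> in \<open>auto simp: linear_compose bij_comp\<close>)
qed

lemma lie_algebra_transport:
  assumes br: "lie_algebra br" and \<phi>: "linear \<phi>" "bij \<phi>"
  defines "br' \<equiv> (\<lambda>x y. \<phi> (br (inv \<phi> x) (inv \<phi> y)))"
  shows "lie_algebra br'" "lie_isomorphic br br'"
proof -
  note i = linear_bij_inv[OF \<phi>]
  have bil: "bilinear br" and alt: "\<And>x. br x x = 0"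
    and jac: "\<And>x y z. br x (br y z) + br y (br z x) + br z (br x y) = 0"
    using br by (auto simp: lie_algebra_def)
  note b = bilinear_ladd[OF bil] bilinear_radd[OF bil] bilinear_lmul[OF bil] bilinear_rmul[OF bil]
  note l = linear_add[OF \<phi>(1)] linear_scale[OF \<phi>(1)] linear_add[OF i(1)] linear_scale[OF i(1)]
  have "bilinear br'"
    unfolding bilinear_def br'_def by (auto intro!: linearI simp: b l)
  moreover have "br' x (br' y z) + br' y (br' z x) + br' z (br' x y) = 0" for x y z
    using jac[of "inv \<phi> x" "inv \<phi> y" "inv \<phi> z"]
    by (simp add: br'_def i(4) flip: l) (simp add: linear_0[OF \<phi>(1)])
  ultimately show "lie_algebra br'"
    by (simp add: lie_algebra_def br'_def alt linear_0[OF \<phi>(1)])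
  show "lie_isomorphic br br'"
    unfolding lie_isomorphic_def br'_def using \<phi> i(4) by auto
qed

lemma bilinear_alternating_skew:
  assumes "bilinear br" "\<And>x. br x x = 0"
  shows "br x y = - br y x"
proof -
  have "br (x + y) (x + y) = br x x + br y y + (br x y + br y x)"
    by (simp only: bilinear_ladd[OF assms(1)] bilinear_radd[OF assms(1)]) (simp only: ac_simps)
  then show ?thesis
    by (simp add: assms(2) eq_neg_iff_add_eq_0)
qed

text \<open>Sending \<open>(0, 1)\<close> to \<open>(w, c)\<close> shows that scaling
  \<open>D\<close> and adding an inner derivation do not change the extension.\<close>

lemma lie_isomorphic_D_extension:
  assumes P: "linear P" "bij P" "\<And>x y. P (br' x y) = br (P x) (P y)"
    and br: "bilinear br" "\<And>x. br x x = 0" and D: "linear D"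
    and c: "c \<noteq> 0"
    and PD: "\<And>x. P (D' x) = c *\<^sub>R D (P x) + br (P x) w"
  shows "lie_isomorphic (D_extension br' D') (D_extension br D)"
proof -
  define \<phi> where "\<phi> = (\<lambda>(x, s). (P x + s *\<^sub>R w, c * s))"
  define \<psi> where "\<psi> = (\<lambda>(x, s). (inv P (x - (s / c) *\<^sub>R w), s / c))"
  note i = linear_bij_inv[OF P(1,2)]
  note anti = bilinear_alternating_skew[OF br]
  have "linear \<phi>"
    by (rule linearI) (auto simp: \<phi>_def linear_add[OF P(1)] linear_scale[OF P(1)] algebra_simps)
  moreover have "bij \<phi>"
    by (rule o_bij[of \<psi>]) (use c in \<open>auto simp: \<phi>_def \<psi>_def fun_eq_iff i\<close>)
  moreover have "\<phi> (D_extension br' D' x y) = D_extension br D (\<phi> x) (\<phi> y)" for x y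
  proof -
    obtain a r where x: "x = (a, r)" by (cases x)
    obtain b s where y: "y = (b, s)" by (cases y)
    have *: "br w (P b) = - br (P b) w"
      by (rule anti)
    show ?thesis
      by (simp add: x y \<phi>_def D_extension_def linear_add[OF P(1)] linear_diff[OF P(1)]
          linear_scale[OF P(1)] P(3) PD linear_add[OF D] linear_scale[OF D] algebra_simps
          bilinear_ladd[OF br(1)] bilinear_radd[OF br(1)] bilinear_lmul[OF br(1)]
          bilinear_rmul[OF br(1)] br(2) *)
  qed
  ultimately show ?thesis
    unfolding lie_isomorphic_def by blast
qed

text \<open>The remaining conjuncts of the theorem, unimodularity and the derivation property, come
  from \<open>listed_imp\<close>.\<close>

definition classified :: "('a::real_vector \<Rightarrow> 'a \<Rightarrow> 'a) \<Rightarrow> bool" where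
  "classified br \<longleftrightarrow> (\<exists>f M. listed f M \<and> lie_isomorphic br (D_extension (lie_of f) ((*v) M)))"

lemma classified_isomorphic:
  "lie_isomorphic br br' \<Longrightarrow> classified br' \<Longrightarrow> classified br"
  unfolding classified_def using lie_isomorphic_trans by blast

text \<open>Quantifying over every derivation allows the ideal to be normalised first, without
  tracking \<open>D\<close>.\<close>

definition extensions_classified :: "(real^3 \<Rightarrow> real^3 \<Rightarrow> real^3) \<Rightarrow> bool" where
  "extensions_classified br \<longleftrightarrow> (\<forall>D. derivation br D \<longrightarrow> classified (D_extension br D))"

lemma extensions_classified_isomorphic:
  assumes "lie_isomorphic br br'" "lie_algebra br'" "extensions_classified br'"
  shows "extensions_classified br"
  unfolding extensions_classified_def
proof (intro allI impI)
  fix D assume D: "derivation br D"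
  obtain \<phi> where \<phi>: "linear \<phi>" "bij \<phi>" "\<And>x y. \<phi> (br x y) = br' (\<phi> x) (\<phi> y)"
    using assms by (auto simp: lie_isomorphic_def)
  note i = linear_bij_inv[OF \<phi>(1,2)]
  define D' where "D' = \<phi> \<circ> D \<circ> inv \<phi>"
  have linD: "linear D" and der: "\<And>x y. D (br x y) = br (D x) y + br x (D y)"
    using D by (auto simp: derivation_def)
  have linD': "linear D'"
    unfolding D'_def by (intro linear_compose \<phi> i linD)
  have "inv \<phi> (br' x y) = br (inv \<phi> x) (inv \<phi> y)" for x y
    using \<phi>(3)[of "inv \<phi> x" "inv \<phi> y"] by (metis i(3,4))
  then have "derivation br' D'"
    using linD' by (simp add: derivation_def D'_def der linear_add[OF \<phi>(1)] \<phi>(3) i)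
  then have "classified (D_extension br' D')"
    using assms(3) by (simp add: extensions_classified_def)
  moreover have "lie_isomorphic (D_extension br D) (D_extension br' D')"
    by (rule lie_isomorphic_D_extension[where P=\<phi> and c=1 and w=0])
      (use assms(2) linD' \<phi> in \<open>auto simp: lie_algebra_def bilinear_rzero D'_def i\<close>)
  ultimately show "classified (D_extension br D)"
    using classified_isomorphic by blast
qed

section \<open>Brackets given by a cross product\<close>

text \<open>Unimodular three-dimensional Lie algebras are exactly those with \<open>S\<close> symmetric.\<close>

definition cross_bracket :: "real^3^3 \<Rightarrow> real^3 \<Rightarrow> real^3 \<Rightarrow> real^3" where
  "cross_bracket S x y = S *v (x \<times> y)"

definition diag3 :: "real \<Rightarrow> real \<Rightarrow> real \<Rightarrow> real^3^3" where
  "diag3 a b c = mat3 a 0 0 0 b 0 0 0 c"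

section \<open>Calculus of explicit three-by-three matrices\<close>

lemma mat3_entries:
  "mat3 a b c d e f g h i $ 1 $ 1 = a" "mat3 a b c d e f g h i $ 1 $ 2 = b" "mat3 a b c d e f g h i $ 1 $ 3 = c"
  "mat3 a b c d e f g h i $ 2 $ 1 = d" "mat3 a b c d e f g h i $ 2 $ 2 = e" "mat3 a b c d e f g h i $ 2 $ 3 = f"
  "mat3 a b c d e f g h i $ 3 $ 1 = g" "mat3 a b c d e f g h i $ 3 $ 2 = h" "mat3 a b c d e f g h i $ 3 $ 3 = i"
  by (simp_all add: mat3_def)

lemma mat3_eta:
  "A = mat3 (A$1$1) (A$1$2) (A$1$3) (A$2$1) (A$2$2) (A$2$3) (A$3$1) (A$3$2) (A$3$3)"
  by (simp add: vec_eq_iff forall_3 mat3_entries)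

lemma mat3_vector_mult:
  "mat3 a b c d e f g h i *v x =
     vector [a * x$1 + b * x$2 + c * x$3, d * x$1 + e * x$2 + f * x$3, g * x$1 + h * x$2 + i * x$3]"
  by (simp add: vec_eq_iff forall_3 mat3_entries matrix_vector_mult_def sum_3)

lemma mat3_mult:
  "mat3 a b c d e f g h i ** mat3 a' b' c' d' e' f' g' h' i' =
   mat3 (a*a' + b*d' + c*g') (a*b' + b*e' + c*h') (a*c' + b*f' + c*i')
        (d*a' + e*d' + f*g') (d*b' + e*e' + f*h') (d*c' + e*f' + f*i')
        (g*a' + h*d' + i*g') (g*b' + h*e' + i*h') (g*c' + h*f' + i*i')"
  by (simp add: vec_eq_iff forall_3 mat3_entries matrix_matrix_mult_def sum_3)

lemma transpose_mat3: "transpose (mat3 a b c d e f g h i) = mat3 a d g b e h c f i"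
  by (simp add: vec_eq_iff forall_3 mat3_entries transpose_def)

lemma scaleR_mat3:
  "r *\<^sub>R mat3 a b c d e f g h i = mat3 (r*a) (r*b) (r*c) (r*d) (r*e) (r*f) (r*g) (r*h) (r*i)"
  by (simp add: vec_eq_iff forall_3 mat3_entries)

lemma det_mat3:
  "det (mat3 a b c d e f g h i) = a*e*i + b*f*g + c*d*h - a*f*h - b*d*i - c*e*g"
  by (simp add: det_3 mat3_entries)

lemma mat3_eq_iff:
  "mat3 a b c d e f g h i = mat3 a' b' c' d' e' f' g' h' i' \<longleftrightarrow>
   a = a' \<and> b = b' \<and> c = c' \<and> d = d' \<and> e = e' \<and> f = f' \<and> g = g' \<and> h = h' \<and> i = i'"
  by (auto simp: vec_eq_iff forall_3 mat3_entries)

lemma add_mat3: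
  "mat3 a b c d e f g h i + mat3 a' b' c' d' e' f' g' h' i' =
   mat3 (a+a') (b+b') (c+c') (d+d') (e+e') (f+f') (g+g') (h+h') (i+i')"
  by (simp add: vec_eq_iff forall_3 mat3_entries)

lemma trace_mat3: "trace (mat3 a b c d e f g h i) = a + e + i"
  by (simp add: trace_def sum_3 mat3_entries)

lemma zero_mat3: "0 = mat3 0 0 0 0 0 0 0 0 0"
  by (simp add: vec_eq_iff forall_3 mat3_entries)

lemmas mat3_simps = mat3_mult transpose_mat3 scaleR_mat3 add_mat3 trace_mat3 det_mat3 mat3_eq_iff

lemma bilinear_cross_bracket: "bilinear (cross_bracket S)"
  unfolding bilinear_def cross_bracket_def
  by (auto intro!: linearI simp: cross_add_left cross_add_right cross_mult_left cross_mult_right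
      matrix_vector_right_distrib matrix_vector_mult_scaleR)

lemma cross_bracket_self: "cross_bracket S x x = 0"
  by (simp add: cross_bracket_def)

text \<open>The cyclic sum of \<open>x \<times> (S *v (y \<times> z))\<close> is trilinear and
  alternating, hence determined by its value on the standard basis. There it is the sum of
  \<open>e_i \<times> (S *v e_i)\<close>, which vanishes for symmetric \<open>S\<close>.\<close>

lemma lie_algebra_cross_bracket:
  assumes "transpose S = S"
  shows "lie_algebra (cross_bracket S)"
proof -
  have "transpose S $ i $ j = S $ j $ i" for i j
    by (simp add: transpose_def)
  then have s: "S$1$2 = S$2$1" "S$1$3 = S$3$1" "S$2$3 = S$3$2"
    unfolding assms by blast+
  have "cross_bracket S x (cross_bracket S y z) + cross_bracket S y (cross_bracket S z x)
      + cross_bracket S z (cross_bracket S x y) = 0" for x y z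
  proof -
    have "x \<times> (S *v (y \<times> z)) + y \<times> (S *v (z \<times> x)) + z \<times> (S *v (x \<times> y)) = 0"
      unfolding vec_eq_iff forall_3
      by (simp add: matrix_vector_mult_def sum_3 cross_components s) (simp add: algebra_simps)
    then show ?thesis
      unfolding cross_bracket_def matrix_vector_right_distrib[symmetric] by simp
  qed
  then show ?thesis
    using bilinear_cross_bracket cross_bracket_self by (auto simp: lie_algebra_def)
qed

lemma lie_of_diagonal_form_cross_bracket:
  "lie_of (diagonal_form a1 a2 a3) = cross_bracket (diag3 (2 * a1) (2 * a2) (2 * a3))"
  by (simp add: fun_eq_iff lie_of_diagonal_form cross_bracket_def diag3_def mat3_vector_mult cross3_def)

lemma matrix_vector_mult_bij:
  fixes P :: "real^3^3"
  assumes "det P \<noteq> 0"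
  shows "bij ((*v) P)"
  using assms by (metis invertible_det_nz invertible_eq_bij)

text \<open>Cofactor identity: \<open>transpose P\<close> maps
  \<open>(P *v x) \<times> (P *v y)\<close> to \<open>det P\<close> times
  \<open>x \<times> y\<close>.\<close>

lemma cross_bracket_congruence:
  fixes P :: "real^3^3"
  assumes "det P \<noteq> 0" "P ** S' ** transpose P = det P *\<^sub>R S"
  shows "P *v cross_bracket S' x y = cross_bracket S (P *v x) (P *v y)"
proof -
  have "det P *\<^sub>R cross_bracket S (P *v x) (P *v y) = (P ** S' ** transpose P) *v ((P *v x) \<times> (P *v y))"
    by (simp add: cross_bracket_def assms(2) scaleR_matrix_vector_assoc)
  also have "\<dots> = det P *\<^sub>R (P *v cross_bracket S' x y)"
    by (simp add: cross_matrix_mult cross_bracket_def matrix_vector_mult_scaleR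
        flip: matrix_vector_mul_assoc del: transpose_matrix_vector)
  finally show ?thesis
    using assms(1) by simp
qed

lemma lie_isomorphic_cross_bracket:
  fixes P :: "real^3^3"
  assumes "det P \<noteq> 0" "P ** S' ** transpose P = det P *\<^sub>R S"
  shows "lie_isomorphic (cross_bracket S') (cross_bracket S)"
  unfolding lie_isomorphic_def
  by (rule exI[of _ "(*v) P"])
    (use assms matrix_vector_mult_bij cross_bracket_congruence[OF assms] in auto)

abbreviation ext :: "real^3^3 \<Rightarrow> real^3^3 \<Rightarrow> (real^3) \<times> real \<Rightarrow> (real^3) \<times> real \<Rightarrow> (real^3) \<times> real" where
  "ext S M \<equiv> D_extension (cross_bracket S) ((*v) M)"

text \<open>Sending \<open>e\<close> to \<open>c e + (u, v, t)\<close> adds the inner part \<open>S (x \<times> (u, v, t))\<close> to \<open>c M\<close>; the last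
  matrix below is \<open>x \<mapsto> x \<times> (u, v, t)\<close>.\<close>

lemma lie_isomorphic_ext:
  fixes P :: "real^3^3"
  assumes "det P \<noteq> 0" "P ** S' ** transpose P = det P *\<^sub>R S" "c \<noteq> 0"
    and PM: "P ** M' = c *\<^sub>R (M ** P) + S ** mat3 0 t (-v) (-t) 0 u v (-u) 0 ** P"
  shows "lie_isomorphic (ext S' M') (ext S M)"
proof (rule lie_isomorphic_D_extension[where P="(*v) P" and w="vector [u, v, t]" and c=c])
  fix x
  have "y \<times> vector [u, v, t] = mat3 0 t (-v) (-t) 0 u v (-u) 0 *v y" for y
    by (simp add: mat3_vector_mult cross3_def mult.commute)
  then show "P *v (M' *v x) = c *\<^sub>R (M *v (P *v x)) + cross_bracket S (P *v x) (vector [u, v, t])"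
    by (simp add: cross_bracket_def matrix_vector_mul_assoc matrix_mul_assoc PM matrix_vector_mult_add_rdistrib
        flip: scaleR_matrix_vector_assoc)
qed (use assms matrix_vector_mult_bij cross_bracket_congruence[OF assms(1,2)] bilinear_cross_bracket
      cross_bracket_self in auto)

text \<open>\<open>P\<close> leads from the settled extension \<open>ext S' M'\<close> to the one in
  question.\<close>

lemma classified_ext:
  fixes P :: "real^3^3"
  assumes "classified (ext S' M')" "det P \<noteq> 0" "P ** S' ** transpose P = det P *\<^sub>R S" "c \<noteq> 0"
    and "P ** M' = c *\<^sub>R (M ** P) + S ** mat3 0 t (-v) (-t) 0 u v (-u) 0 ** P"
  shows "classified (ext S M)"
  using classified_isomorphic lie_isomorphic_sym lie_isomorphic_ext[OF assms(2-)] assms(1) by blast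

lemma classified_ext_abelian:
  fixes P :: "real^3^3"
  assumes "classified (ext 0 M')" "det P \<noteq> 0" "c \<noteq> 0" "P ** M' = c *\<^sub>R (M ** P)"
  shows "classified (ext 0 M)"
  by (rule classified_ext[where u=0 and v=0 and t=0]) (use assms in auto)

lemma diag3_zero: "diag3 0 0 0 = 0"
  by (simp add: diag3_def zero_mat3)

section \<open>Extensions on the list\<close>

lemma listed_forms:
  "(\<lambda>p. 0) = diagonal_form 0 0 0"
  "(\<lambda>p. (p $ 1)\<^sup>2 + (p $ 2)\<^sup>2 + (p $ 3)\<^sup>2) = diagonal_form 1 1 1"
  "(\<lambda>p. (p $ 1)\<^sup>2 + (p $ 2)\<^sup>2 - (p $ 3)\<^sup>2) = diagonal_form 1 1 (- 1)"
  "(\<lambda>p. (p $ 1)\<^sup>2 + (p $ 2)\<^sup>2) = diagonal_form 1 1 0"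
  "(\<lambda>p. (p $ 1)\<^sup>2 - (p $ 2)\<^sup>2) = diagonal_form 1 (- 1) 0"
  "(\<lambda>p. (p $ 1)\<^sup>2) = diagonal_form 1 0 0"
  by (auto simp: diagonal_form_def fun_eq_iff)

lemma classified_diagonal_form:
  "listed (diagonal_form a b c) M \<Longrightarrow> classified (ext (diag3 (2 * a) (2 * b) (2 * c)) M)"
  using lie_isomorphic_refl unfolding classified_def lie_of_diagonal_form_cross_bracket[symmetric] by blast

text \<open>The order is that of the rules of \<open>listed\<close>; later proofs cite by position.
  Differentiating the squares doubles the coefficients.\<close>

lemma classified_listed:
  "classified (ext 0 0)"
  "classified (ext 0 (mat3 0 1 0 0 0 1 0 0 0))"
  "classified (ext 0 (mat3 1 0 0 0 0 1 0 0 0))"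
  "classified (ext 0 (mat3 1 1 0 0 1 1 0 0 1))"
  "classified (ext 0 (mat3 1 1 0 0 1 0 0 0 \<alpha>))"
  "classified (ext 0 (mat3 1 0 0 0 \<beta> 0 0 0 \<gamma>))"
  "classified (ext 0 (mat3 \<delta> 1 0 (-1) \<delta> 0 0 0 \<epsilon>))"
  "classified (ext (diag3 2 2 2) 0)"
  "classified (ext (diag3 2 2 (-2)) 0)"
  "classified (ext (diag3 2 2 0) 0)"
  "classified (ext (diag3 2 2 0) (mat3 1 0 0 0 1 0 0 0 0))"
  "classified (ext (diag3 2 (-2) 0) 0)"
  "classified (ext (diag3 2 (-2) 0) (mat3 1 0 0 0 1 0 0 0 0))"
  "classified (ext (diag3 2 0 0) 0)"
  "classified (ext (diag3 2 0 0) (mat3 0 0 0 0 1 0 0 0 (-1)))"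
  "classified (ext (diag3 2 0 0) (mat3 0 0 0 0 0 1 0 (-1) 0))"
  "classified (ext (diag3 2 0 0) (mat3 2 0 0 0 1 1 0 0 1))"
  "classified (ext (diag3 2 0 0) (mat3 2 0 0 0 1 \<kappa> 0 (-\<kappa>) 1))"
  "classified (ext (diag3 2 0 0) (mat3 1 0 0 0 \<zeta> 0 0 0 (1 - \<zeta>)))"
  using listed.intros[unfolded listed_forms, THEN classified_diagonal_form, simplified, unfolded diag3_zero]
  by simp_all

text \<open>\<open>(k, l; m, n)\<close> is the matrix of \<open>(p, q; r, s)\<close> in the basis \<open>(a, c), (b, d)\<close>.\<close>

lemma canonical_form_2x2:
  fixes p q r s :: real
  obtains a b c d k l m n where "a * d - b * c \<noteq> 0"
    and "p * a + q * c = a * k + b * m" "p * b + q * d = a * l + b * n"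
    and "r * a + s * c = c * k + d * m" "r * b + s * d = c * l + d * n"
    and "k + n = p + s"
    and "l = 0 \<and> m = 0 \<or> l = 1 \<and> m = 0 \<and> k = n \<or> k = n \<and> m = - l \<and> l \<noteq> 0"
proof -
  \<comment> \<open>\<open>\<Delta>\<close> is the discriminant of the characteristic polynomial.
    The witnesses below are given in the order \<open>a d b c k m l n\<close>, in which the
    variables first occur.\<close>
  define \<Delta> where "\<Delta> = (p - s)\<^sup>2 + 4 * q * r"
  consider "r = 0" "p \<noteq> s" | "r = 0" "p = s" "q = 0" | "r = 0" "p = s" "q \<noteq> 0"
    | "r \<noteq> 0" "\<Delta> > 0" | "r \<noteq> 0" "\<Delta> = 0" | "r \<noteq> 0" "\<Delta> < 0" | "r = 0" "\<Delta> < 0"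
    by linarith
  then show thesis
  proof cases
    case 1
    show thesis
      by (rule that[of 1 "s - p" q 0 p 0 0 s]) (use 1 in \<open>auto simp: algebra_simps\<close>)
  next
    case 2
    show thesis
      by (rule that[of 1 1 0 0 p 0 0 p]) (use 2 in \<open>auto simp: algebra_simps\<close>)
  next
    case 3
    show thesis
      by (rule that[of q 1 0 0 p 0 1 p]) (use 3 in \<open>auto simp: algebra_simps\<close>)
  next
    case 4
    \<comment> \<open>The new basis consists of the eigenvectors \<open>(\<lambda> - s, r)\<close>
      for the two real eigenvalues \<open>\<lambda>\<close>.\<close>
    define t where "t = sqrt \<Delta>"
    have t: "t > 0" "t * t = (p - s) * (p - s) + 4 * q * r"
      using 4 by (simp_all add: t_def \<Delta>_def power2_eq_square)
    show thesis
      by (rule that[of "((p + s + t) / 2 - s)" r "(p + s - t) / 2 - s" r "(p + s + t) / 2" 0 0 "(p + s - t) / 2"])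
        (use 4 t in \<open>auto simp: field_simps\<close>)
  next
    case 5
    have t: "0 = (p - s) * (p - s) + 4 * q * r"
      using 5 by (simp_all add: \<Delta>_def power2_eq_square)
    \<comment> \<open>A Jordan chain: the matrix minus its double eigenvalue maps
      \<open>(1, 0)\<close> to the eigenvector.\<close>
    show thesis
      by (rule that[of "(p - s) / 2" 0 1 r "(p + s) / 2" 0 1 "(p + s) / 2"])
        (use 5 t in \<open>auto simp: field_simps\<close>)
  next
    case 6
    \<comment> \<open>The eigenvalue \<open>(p + s) / 2 + i t\<close> has eigenvector
      \<open>(\<lambda> - s, r)\<close>; its imaginary part and minus its real part form the
      basis.\<close>
    define t where "t = sqrt (- \<Delta>) / 2"
    have t: "t > 0" "- 4 * (t * t) = (p - s) * (p - s) + 4 * q * r"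
      using 6 by (simp_all add: t_def \<Delta>_def power2_eq_square)
    show thesis
      by (rule that[of t "- r" "- (p - s) / 2" 0 "(p + s) / 2" "- t" t "(p + s) / 2"])
        (use 6 t in \<open>auto simp: field_simps\<close>)
  next
    case 7
    then show thesis
      by (simp add: \<Delta>_def not_less)
  qed
qed

section \<open>Abelian ideals\<close>

lemma classified_abelian_diag: "classified (ext 0 (diag3 a b c))"
proof -
  consider "a \<noteq> 0" | "a = 0" "b \<noteq> 0" | "a = 0" "b = 0" "c \<noteq> 0" | "a = 0" "b = 0" "c = 0"
    by blast
  then show ?thesis
  proof cases
    case 1
    show ?thesis
      by (rule classified_ext_abelian[OF classified_listed(6)[of "b / a" "c / a"], of "diag3 1 1 1" "1 / a"])
        (use 1 in \<open>simp_all add: diag3_def mat3_simps\<close>)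
  next
    case 2
    show ?thesis
      by (rule classified_ext_abelian[OF classified_listed(6)[of 0 "c / b"], of "mat3 0 1 0 1 0 0 0 0 1" "1 / b"])
        (use 2 in \<open>simp_all add: diag3_def mat3_simps\<close>)
  next
    case 3
    show ?thesis
      by (rule classified_ext_abelian[OF classified_listed(6)[of 0 0], of "mat3 0 0 1 0 1 0 1 0 0" "1 / c"])
        (use 3 in \<open>simp_all add: diag3_def mat3_simps\<close>)
  next
    case 4
    then show ?thesis
      using classified_listed(1) by (simp add: diag3_def zero_mat3)
  qed
qed

text \<open>Only \<open>[e_2, e] = e_1\<close> survives. Exchanging \<open>e\<close> with the
  central \<open>e_3\<close> and doubling \<open>e_1\<close> gives the trivial extension of the
  Heisenberg ideal.\<close>

lemma classified_abelian_nilpotent: "classified (ext 0 (mat3 0 1 0 0 0 0 0 0 0))"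
proof -
  let ?\<phi> = "\<lambda>(x::real^3, s::real). (vector [2 * x $ 1, x $ 2, s]::real^3, x $ 3)"
  let ?\<psi> = "\<lambda>(x::real^3, s::real). (vector [x $ 1 / 2, x $ 2, s]::real^3, x $ 3)"
  have "lie_isomorphic (ext 0 (mat3 0 1 0 0 0 0 0 0 0)) (ext (diag3 2 0 0) 0)"
    unfolding lie_isomorphic_def
  proof (intro exI conjI allI)
    show "linear ?\<phi>"
      by (rule linearI) (auto simp: vec_eq_iff forall_3 algebra_simps add_divide_distrib)
    show "bij ?\<phi>"
      by (rule o_bij[of ?\<psi>]) (auto simp: fun_eq_iff vec_eq_iff forall_3)
    show "?\<phi> (ext 0 (mat3 0 1 0 0 0 0 0 0 0) x y) = ext (diag3 2 0 0) 0 (?\<phi> x) (?\<phi> y)" for x y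
      by (cases x, cases y) (simp add: D_extension_def cross_bracket_def diag3_def mat3_vector_mult
          cross_components vec_eq_iff forall_3 field_simps)
  qed
  then show ?thesis
    using classified_isomorphic classified_listed(14) by blast
qed

text \<open>The span of \<open>e_1\<close>, \<open>e_2\<close>, \<open>e\<close> is an abelian ideal
  on which \<open>e_3\<close> acts by one nilpotent Jordan block. Exchanging \<open>e\<close> and
  \<open>e_3\<close> reverses a bracket, whence the signs.\<close>

lemma classified_heisenberg_nilpotent: "classified (ext (diag3 2 0 0) (mat3 0 0 0 0 0 1 0 0 0))"
proof -
  let ?\<psi> = "\<lambda>(x::real^3, s::real). (vector [- 2 * x $ 1, - x $ 2, s]::real^3, x $ 3)"
  let ?\<phi> = "\<lambda>(x::real^3, s::real). (vector [- x $ 1 / 2, - x $ 2, s]::real^3, x $ 3)"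
  have "lie_isomorphic (ext 0 (mat3 0 1 0 0 0 1 0 0 0)) (ext (diag3 2 0 0) (mat3 0 0 0 0 0 1 0 0 0))"
    unfolding lie_isomorphic_def
  proof (intro exI conjI allI)
    show "linear ?\<psi>"
      by (rule linearI) (auto simp: vec_eq_iff forall_3 algebra_simps)
    show "bij ?\<psi>"
      by (rule o_bij[of ?\<phi>]) (auto simp: fun_eq_iff vec_eq_iff forall_3)
    show "?\<psi> (ext 0 (mat3 0 1 0 0 0 1 0 0 0) x y)
        = ext (diag3 2 0 0) (mat3 0 0 0 0 0 1 0 0 0) (?\<psi> x) (?\<psi> y)" for x y
      by (cases x, cases y) (simp add: D_extension_def cross_bracket_def diag3_def mat3_vector_mult
          cross_components vec_eq_iff forall_3 algebra_simps)
  qed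
  then show ?thesis
    using classified_isomorphic lie_isomorphic_sym classified_listed(2) by blast
qed

text \<open>Scaling by \<open>1 / a\<close> also alters the off-diagonal 1; conjugation by
  \<open>diag3 1 a 1\<close> restores it.\<close>

lemma classified_abelian_jordan2: "classified (ext 0 (mat3 a 1 0 0 a 0 0 0 c))"
proof -
  consider "a \<noteq> 0" | "a = 0" "c \<noteq> 0" | "a = 0" "c = 0"
    by blast
  then show ?thesis
  proof cases
    case 1
    show ?thesis
      by (rule classified_ext_abelian[OF classified_listed(5)[of "c / a"], of "diag3 1 a 1" "1 / a"])
        (use 1 in \<open>simp_all add: diag3_def mat3_simps\<close>)
  next
    case 2
    show ?thesis
      by (rule classified_ext_abelian[OF classified_listed(3), of "mat3 0 (1 / c) 0 0 0 1 1 0 0" "1 / c"])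
        (use 2 in \<open>simp_all add: diag3_def mat3_simps\<close>)
  next
    case 3
    then show ?thesis
      using classified_abelian_nilpotent by simp
  qed
qed

lemma classified_abelian_jordan3: "classified (ext 0 (mat3 a 1 0 0 a 1 0 0 a))"
proof (cases "a = 0")
  case True
  then show ?thesis
    using classified_listed(2) by simp
next
  case False
  show ?thesis
    by (rule classified_ext_abelian[OF classified_listed(4), of "diag3 1 a (a * a)" "1 / a"])
      (use False in \<open>simp_all add: diag3_def mat3_simps\<close>)
qed

lemma classified_abelian_rotation:
  assumes "b \<noteq> 0"
  shows "classified (ext 0 (mat3 a b 0 (-b) a 0 0 0 c))"
  by (rule classified_ext_abelian[OF classified_listed(7)[of "a / b" "c / b"], of "diag3 1 1 1" "1 / b"])
    (use assms in \<open>simp_all add: diag3_def mat3_simps\<close>)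

text \<open>Conjugation by a shear adds to the last column the block minus \<open>e\<close>, applied
  to \<open>(h, k)\<close>. The column can thus be cleared if \<open>e\<close> is not an eigenvalue
  of the block.\<close>

lemma classified_abelian_shear:
  assumes "classified (ext 0 (mat3 a b (x + (a - e) * h + b * k) c d (y + c * h + (d - e) * k) 0 0 e))"
  shows "classified (ext 0 (mat3 a b x c d y 0 0 e))"
  by (rule classified_ext_abelian[OF assms, of "mat3 1 0 h 0 1 k 0 0 1" 1])
    (simp_all add: mat3_simps algebra_simps)

lemma classified_abelian_block_diag: "classified (ext 0 (mat3 a 0 x 0 b y 0 0 c))"
proof -
  have reduced: "classified (ext 0 (mat3 a 0 x 0 b y 0 0 c))"
    if xy: "x = 0 \<or> a = c" "y = 0 \<or> b = c" for x y
  proof -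
    consider "x = 0" "y = 0" | "x \<noteq> 0" "y = 0" "a = c" | "y \<noteq> 0" "x = 0" "b = c"
      | "x \<noteq> 0" "y \<noteq> 0" "a = c" "b = c"
      using xy by blast
    then show ?thesis
    proof cases
      case 1
      then show ?thesis
        using classified_abelian_diag by (simp add: diag3_def)
    next
      case 2
      show ?thesis
        by (rule classified_ext_abelian[OF classified_abelian_jordan2[of a b], of "mat3 x 0 0 0 0 1 0 1 0" 1])
          (use 2 in \<open>simp_all add: mat3_simps\<close>)
    next
      case 3
      show ?thesis
        by (rule classified_ext_abelian[OF classified_abelian_jordan2[of b a], of "mat3 0 0 1 y 0 0 0 1 0" 1])
          (use 3 in \<open>simp_all add: mat3_simps\<close>)
    next
      case 4
      \<comment> \<open>The basis is \<open>(x, y, 0)\<close>, \<open>e_3\<close>,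
        \<open>e_1\<close>: the matrix maps \<open>e_3\<close> to \<open>(x, y, 0) + c e_3\<close>,
        so the first two span a Jordan block.\<close>
      show ?thesis
        by (rule classified_ext_abelian[OF classified_abelian_jordan2[of c c], of "mat3 x 0 1 y 0 0 0 1 0" 1])
          (use 4 in \<open>simp_all add: mat3_simps\<close>)
    qed
  qed
  \<comment> \<open>An entry is cleared if its eigenvalue differs from \<open>c\<close>; otherwise
    the parameter 0 leaves it, as \<open>reduced\<close> permits.\<close>
  show ?thesis
    by (rule classified_abelian_shear[where h="if a = c then 0 else x / (c - a)"
          and k="if b = c then 0 else y / (c - b)"], simp only: mult_zero_left add_0_right, rule reduced)
      (auto simp: field_simps)
qed

lemma classified_abelian_block_jordan: "classified (ext 0 (mat3 a 1 x 0 a y 0 0 c))"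
proof (cases "a = c")
  case True
  have "classified (ext 0 (mat3 a 1 0 0 a y 0 0 a))"
  proof (cases "y = 0")
    case True
    then show ?thesis
      using classified_abelian_jordan2 by simp
  next
    case False
    show ?thesis
      by (rule classified_ext_abelian[OF classified_abelian_jordan3[of a], of "diag3 y y 1" 1])
        (use False in \<open>simp_all add: diag3_def mat3_simps\<close>)
  qed
  then show ?thesis
    by - (rule classified_abelian_shear[where h=0 and k="-x"], simp add: True)
next
  case False
  \<comment> \<open>Back substitution: \<open>k\<close> clears \<open>y\<close>, then
    \<open>h\<close> clears \<open>x + k\<close>.\<close>
  define k where "k = y / (c - a)"
  define h where "h = (x + k) / (c - a)"
  have "(a - c) * k = - y"
    using False by (simp add: k_def field_simps)
  moreover have "(a - c) * h = - x - k"
    using False unfolding h_def by (simp add: field_simps)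
  ultimately have "x + (a - c) * h + k = 0" "y + (a - c) * k = 0"
    by simp_all
  then show ?thesis
    using classified_abelian_jordan2[of a c]
    by - (rule classified_abelian_shear[where h=h and k=k], simp)
qed

lemma classified_abelian_block_rotation:
  assumes "b \<noteq> 0"
  shows "classified (ext 0 (mat3 a b x (-b) a y 0 0 c))"
proof -
  \<comment> \<open>\<open>e\<close> is the determinant of the block minus \<open>c\<close>, nonzero
    because the block has no real eigenvalue. Cramer's rule gives \<open>h\<close> and
    \<open>k\<close>.\<close>
  define e where "e = (a - c) * (a - c) + b * b"
  have e: "e \<noteq> 0"
    unfolding e_def using assms by (simp add: sum_squares_eq_zero_iff)
  define h where "h = - ((a - c) * x - b * y) / e"
  define k where "k = - (b * x + (a - c) * y) / e"
  have "x + (a - c) * h + b * k = 0" "y + (- b) * h + (a - c) * k = 0"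
    using e by (simp_all add: h_def k_def field_simps) (simp_all add: e_def algebra_simps)
  then show ?thesis
    using classified_abelian_rotation[OF assms, of a c]
    by - (rule classified_abelian_shear[where h=h and k=k], simp)
qed

lemma classified_abelian_block: "classified (ext 0 (mat3 p q x r s y 0 0 e))"
proof -
  obtain a b c d k l m n where Q: "a * d - b * c \<noteq> 0"
    and eqs: "p * a + q * c = a * k + b * m" "p * b + q * d = a * l + b * n"
      "r * a + s * c = c * k + d * m" "r * b + s * d = c * l + d * n"
    and C: "l = 0 \<and> m = 0 \<or> l = 1 \<and> m = 0 \<and> k = n \<or> k = n \<and> m = - l \<and> l \<noteq> 0"
    by (rule canonical_form_2x2)
  \<comment> \<open>Cramer's rule: \<open>(u, v)\<close> is the column \<open>(x, y)\<close> in the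
    new basis.\<close>
  define u where "u = (d * x - b * y) / (a * d - b * c)"
  define v where "v = (a * y - c * x) / (a * d - b * c)"
  have uv: "a * u + b * v = x" "c * u + d * v = y"
    using Q by (simp_all add: u_def v_def divide_simps) (simp_all add: algebra_simps)
  have "classified (ext 0 (mat3 k l u m n v 0 0 e))"
    using C classified_abelian_block_diag classified_abelian_block_jordan classified_abelian_block_rotation
    by auto
  then show ?thesis
    by (rule classified_ext_abelian[where P="mat3 a b 0 c d 0 0 0 1" and c=1])
      (use Q eqs uv in \<open>simp_all add: mat3_simps\<close>)
qed

section \<open>Heisenberg ideals\<close>

text \<open>A derivation acts on the centre by the trace of the block, so only the normal form of
  the block matters.\<close>

lemma classified_heisenberg_block:
  "classified (ext (diag3 2 0 0) (mat3 (p + s) 0 0 0 p q 0 r s))"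
proof -
  obtain a b c d k l m n where Q: "a * d - b * c \<noteq> 0"
    and eqs: "p * a + q * c = a * k + b * m" "p * b + q * d = a * l + b * n"
      "r * a + s * c = c * k + d * m" "r * b + s * d = c * l + d * n"
    and tr: "k + n = p + s"
    and C: "l = 0 \<and> m = 0 \<or> l = 1 \<and> m = 0 \<and> k = n \<or> k = n \<and> m = - l \<and> l \<noteq> 0"
    by (rule canonical_form_2x2)
  note step = classified_ext[where u=0 and v=0 and t=0]
  \<comment> \<open>The split also asks whether the trace vanishes: a nonzero one is scaled to 1 or
    2.\<close>
  consider "l = 0" "m = 0" "k + n \<noteq> 0" | "l = 0" "m = 0" "n = - k" "k \<noteq> 0" | "l = 0" "m = 0" "k = 0" "n = 0"
    | "l = 1" "m = 0" "k = n" "n \<noteq> 0" | "l = 1" "m = 0" "k = n" "n = 0"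
    | "k = n" "m = - l" "l \<noteq> 0" "n = 0" | "k = n" "m = - l" "l \<noteq> 0" "n \<noteq> 0"
    using C by (smt (verit))
  then have block: "classified (ext (diag3 2 0 0) (mat3 (k + n) 0 0 0 k l 0 m n))"
  proof cases
    case 1
    then have z: "1 - k / (k + n) = n / (k + n)"
      by (simp add: field_simps)
    show ?thesis
      by (rule step[OF classified_listed(19)[of "k / (k + n)"], of "diag3 1 1 1" _ "1 / (k + n)"])
        (use 1 in \<open>simp_all add: z diag3_def mat3_simps\<close>)
  next
    case 2
    show ?thesis
      by (rule step[OF classified_listed(15), of "diag3 1 1 1" _ "1 / k"])
        (use 2 in \<open>simp_all add: diag3_def mat3_simps\<close>)
  next
    case 3
    then show ?thesis
      using classified_listed(14) by (simp flip: zero_mat3)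
  next
    case 4
    show ?thesis
      by (rule step[OF classified_listed(17), of "diag3 n 1 n" _ "1 / n"])
        (use 4 in \<open>simp_all add: diag3_def mat3_simps\<close>)
  next
    case 5
    then show ?thesis
      using classified_heisenberg_nilpotent by simp
  next
    case 6
    show ?thesis
      by (rule step[OF classified_listed(16), of "diag3 1 1 1" _ "1 / l"])
        (use 6 in \<open>simp_all add: diag3_def mat3_simps\<close>)
  next
    case 7
    show ?thesis
      by (rule step[OF classified_listed(18)[of "l / n"], of "diag3 1 1 1" _ "1 / n"])
        (use 7 in \<open>simp_all add: diag3_def mat3_simps\<close>)
  qed
  \<comment> \<open>\<open>e_1\<close> has to be scaled by the determinant of the block, since
    \<open>[e_2, e_3]\<close> is a multiple of it.\<close>
  obtain e where e: "e \<noteq> 0" "e * a * d - e * b * c = e * e"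
    by (rule that[of "a * d - b * c"]) (use Q in \<open>simp_all add: algebra_simps\<close>)
  show ?thesis
    by (rule step[OF block, where P="mat3 e 0 0 0 a b 0 c d" and c=1])
      (use e eqs tr in \<open>simp_all add: mat3_simps diag3_def\<close>)
qed

section \<open>Derivations\<close>

text \<open>By the infinitesimal cofactor identity \<open>*\<close> and since every basis vector is
  a cross product, the Leibniz rule becomes a matrix equation.\<close>

lemma derivation_cross_bracket:
  assumes "derivation (cross_bracket S) ((*v) M)"
  shows "M ** S + S ** transpose M = trace M *\<^sub>R S"
proof -
  have *: "(M *v x) \<times> y + x \<times> (M *v y) = trace M *\<^sub>R (x \<times> y) - transpose M *v (x \<times> y)" for x y
    by (subst (1 2 3 4) mat3_eta[of M])
      (simp add: transpose_mat3 mat3_vector_mult trace_mat3 cross3_def vec_eq_iff forall_3 algebra_simps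
        del: transpose_matrix_vector)
  have "(M ** S + S ** transpose M) *v (x \<times> y) = (trace M *\<^sub>R S) *v (x \<times> y)" for x y
  proof -
    have "M *v (S *v (x \<times> y)) = S *v ((M *v x) \<times> y + x \<times> (M *v y))"
      using assms by (simp add: derivation_def cross_bracket_def matrix_vector_right_distrib)
    then show ?thesis
      unfolding * by (simp add: matrix_vector_mult_add_rdistrib matrix_vector_mult_diff_distrib
          matrix_vector_mult_scaleR matrix_vector_mul_assoc del: transpose_matrix_vector
          flip: scaleR_matrix_vector_assoc)
  qed
  then have "(M ** S + S ** transpose M) *v axis i 1 = (trace M *\<^sub>R S) *v axis i 1" for i
    using exhaust_3[of i] cross_basis(1,3,5) by metis
  then show ?thesis
    by (simp add: matrix_vector_mul_component vec_eq_iff matrix_vector_mult_basis column_def)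
qed

lemma extensions_classifiedI:
  assumes "\<And>M. M ** S + S ** transpose M = trace M *\<^sub>R S \<Longrightarrow> classified (ext S M)"
  shows "extensions_classified (cross_bracket S)"
  unfolding extensions_classified_def
proof (intro allI impI)
  fix D assume D: "derivation (cross_bracket S) D"
  then have "(*v) (matrix D) = D"
    by (simp add: derivation_def fun_eq_iff)
  with D assms derivation_cross_bracket show "classified (D_extension (cross_bracket S) D)"
    by metis
qed

lemma extensions_classified_heisenberg: "extensions_classified (cross_bracket (diag3 2 0 0))"
proof (rule extensions_classifiedI)
  fix M :: "real^3^3"
  obtain d x y g p q h r s where M: "M = mat3 d x y g p q h r s"
    using mat3_eta by blast
  assume "M ** diag3 2 0 0 + diag3 2 0 0 ** transpose M = trace M *\<^sub>R diag3 2 0 0"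
  then have "g = 0" "h = 0" "d = p + s"
    by (auto simp: M diag3_def mat3_simps)
  then show "classified (ext (diag3 2 0 0) M)"
    by (intro classified_ext[OF classified_heisenberg_block[of p s q r],
        where P="diag3 1 1 1" and c=1 and u=0 and t="- x / 2" and v="y / 2"])
      (simp_all add: M diag3_def mat3_simps)
qed

text \<open>Every derivation is a multiple of \<open>diag3 1 1 0\<close> plus an inner one, which
  \<open>u\<close>, \<open>v\<close>, \<open>t\<close> remove.\<close>

lemma extensions_classified_rank2:
  assumes "\<sigma> = 1 \<or> \<sigma> = -1"
  shows "extensions_classified (cross_bracket (diag3 2 (2 * \<sigma>) 0))"
proof (rule extensions_classifiedI)
  let ?S = "diag3 2 (2 * \<sigma>) 0"
  fix M :: "real^3^3"
  obtain a b c d e f g h i where M: "M = mat3 a b c d e f g h i"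
    using mat3_eta by blast
  assume "M ** ?S + ?S ** transpose M = trace M *\<^sub>R ?S"
  then have *: "g = 0" "h = 0" "i = 0" "e = a" "d = - \<sigma> * b"
    using assms by (auto simp: M diag3_def mat3_simps)
  have "classified (ext ?S (mat3 a 0 0 0 a 0 0 0 0))"
  proof (cases "a = 0")
    case True
    then show ?thesis
      using assms classified_listed(10,12) by (auto simp flip: zero_mat3)
  next
    case False
    have "classified (ext ?S (mat3 1 0 0 0 1 0 0 0 0))"
      using assms classified_listed(11,13) by auto
    then show ?thesis
      by (rule classified_ext[where P="diag3 1 1 1" and c="1 / a" and u=0 and t=0 and v=0])
        (use False in \<open>simp_all add: M diag3_def mat3_simps\<close>)
  qed
  then show "classified (ext ?S M)"
    by (rule classified_ext[where P="diag3 1 1 1" and c=1 and u="- \<sigma> * f / 2" and v="c / 2" and t="- b / 2"])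
      (use assms in \<open>auto simp: M * diag3_def mat3_simps\<close>)
qed

text \<open>These algebras are simple, and all their derivations are inner.\<close>

lemma extensions_classified_rank3:
  assumes "\<sigma> = 1 \<or> \<sigma> = -1"
  shows "extensions_classified (cross_bracket (diag3 2 2 (2 * \<sigma>)))"
proof (rule extensions_classifiedI)
  let ?S = "diag3 2 2 (2 * \<sigma>)"
  fix M :: "real^3^3"
  obtain a b c d e f g h i where M: "M = mat3 a b c d e f g h i"
    using mat3_eta by blast
  assume "M ** ?S + ?S ** transpose M = trace M *\<^sub>R ?S"
  then have *: "a = 0" "e = 0" "i = 0" "d = - b" "g = - \<sigma> * c" "h = - \<sigma> * f"
    using assms by (auto simp: M diag3_def mat3_simps)
  have "classified (ext ?S 0)"
    using assms classified_listed(8,9) by auto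
  then show "classified (ext ?S M)"
    by (rule classified_ext[where P="diag3 1 1 1" and c=1 and u="- f / 2" and v="c / 2" and t="- b / 2"])
      (use assms in \<open>auto simp: M * diag3_def mat3_simps zero_mat3\<close>)
qed

section \<open>Triangularisation on abelian ideals\<close>

text \<open>The reflection in the hyperplane orthogonal to \<open>a - b\<close>. Being its own
  inverse, it keeps later conjugations short.\<close>

lemma householder:
  fixes a b :: "'a::real_inner"
  assumes "norm a = norm b"
  obtains f where "linear f" "\<And>x. f (f x) = x" "\<And>x y. f x \<bullet> f y = x \<bullet> y" "f a = b"
proof -
  define u where "u = a - b"
  define f where "f x = x - (2 * (x \<bullet> u) / (u \<bullet> u)) *\<^sub>R u" for x
  have "linear f"
    by (rule linearI) (simp_all add: f_def inner_add_left algebra_simps add_divide_distrib)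
  moreover have u: "f x \<bullet> u = - (x \<bullet> u)" for x
    by (cases "u = 0") (simp_all add: f_def inner_diff_left)
  then have "f (f x) = x" for x
    by (subst f_def) (simp add: u, simp add: f_def)
  moreover have "f x \<bullet> f y = x \<bullet> y" for x y
  proof -
    have "f x \<bullet> f y = f x \<bullet> y - (2 * (y \<bullet> u) / (u \<bullet> u)) * (f x \<bullet> u)"
      by (simp add: f_def[of y] inner_diff_right)
    also have "\<dots> = x \<bullet> y"
      unfolding u by (simp add: f_def inner_diff_left inner_commute[of u y])
    finally show ?thesis .
  qed
  moreover have "f a = b"
  proof (cases "u = 0")
    case False
    have "a \<bullet> a = b \<bullet> b"
      using assms by (simp add: norm_eq)
    then have "2 * (a \<bullet> u) = u \<bullet> u"
      by (simp add: u_def inner_diff_left inner_diff_right inner_commute)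
    then show ?thesis
      using False by (simp add: f_def) (simp add: u_def)
  qed (simp add: f_def u_def)
  ultimately show thesis
    by (rule that)
qed

lemma cubic_has_root:
  fixes a b c :: real
  obtains x where "x ^ 3 + a * x\<^sup>2 + b * x + c = 0"
proof -
  \<comment> \<open>\<open>K\<close> is so large that \<open>K ^ 3\<close> dominates the lower terms
    at \<open>K\<close> and \<open>- K\<close>.\<close>
  define K where "K = 1 + \<bar>a\<bar> + \<bar>b\<bar> + \<bar>c\<bar>"
  have "K \<ge> 1"
    by (simp add: K_def)
  then have K: "K \<ge> 1" "K\<^sup>2 \<ge> K" "K\<^sup>2 \<ge> 1"
    by (simp_all add: self_le_power)
  have "K ^ 3 = K\<^sup>2 * K"
    by (simp add: power2_eq_square power3_eq_cube)
  then have K3: "K ^ 3 = K\<^sup>2 + \<bar>a\<bar> * K\<^sup>2 + \<bar>b\<bar> * K\<^sup>2 + \<bar>c\<bar> * K\<^sup>2"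
    by (simp add: K_def algebra_simps)
  have bounds: "\<bar>a * K\<^sup>2\<bar> \<le> \<bar>a\<bar> * K\<^sup>2" "\<bar>b * K\<bar> \<le> \<bar>b\<bar> * K\<^sup>2" "\<bar>c\<bar> \<le> \<bar>c\<bar> * K\<^sup>2"
    using K by (simp_all add: abs_mult mult_left_mono mult_le_cancel_left1)
  note bounds' = bounds[THEN abs_le_D1] bounds[THEN abs_le_D2]
  have minus: "(- K) ^ 3 = - (K ^ 3)"
    by simp
  have "(- K) ^ 3 + a * (- K)\<^sup>2 + b * (- K) + c \<le> 0" "0 \<le> K ^ 3 + a * K\<^sup>2 + b * K + c"
    using K K3 bounds' by (simp_all only: minus power2_minus)
  then have "\<exists>x\<ge>- K. x \<le> K \<and> x ^ 3 + a * x\<^sup>2 + b * x + c = 0"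
    by (rule IVT') (use K in \<open>auto intro!: continuous_intros\<close>)
  then show thesis
    using that by blast
qed

text \<open>The characteristic polynomial is a cubic and has a real root. The transpose is used
  because the plane orthogonal to its eigenvector is invariant under \<open>M\<close>.\<close>

lemma left_eigenvector_real_3:
  fixes M :: "real^3^3"
  obtains v \<mu> where "norm v = 1" "transpose M *v v = \<mu> *\<^sub>R v"
proof -
  obtain a b c d e f g h i where M: "M = mat3 a b c d e f g h i"
    using mat3_eta by blast
  obtain \<mu> where \<mu>: "\<mu> ^ 3 + (- a - e - i) * \<mu>\<^sup>2 + (a * e + a * i + e * i - b * d - c * g - f * h) * \<mu>
      + (- det M) = 0"
    by (rule cubic_has_root)
  define N where "N = mat3 (a - \<mu>) b c d (e - \<mu>) f g h (i - \<mu>)"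
  have "det (transpose N) = 0"
    using \<mu> by (simp add: M N_def transpose_mat3 det_mat3 power2_eq_square power3_eq_cube algebra_simps)
  then have "\<not> invertible (transpose N)"
    using invertible_det_nz by blast
  then obtain v where v: "transpose N *v v = 0" "v \<noteq> 0"
    unfolding invertible_left_inverse matrix_left_invertible_ker by blast
  have "transpose N *v v = transpose M *v v - \<mu> *\<^sub>R v"
    by (simp add: M N_def transpose_mat3 mat3_vector_mult vec_eq_iff forall_3 algebra_simps
        del: transpose_matrix_vector)
  with v have "transpose M *v v = \<mu> *\<^sub>R v"
    by simp
  then have "transpose M *v ((1 / norm v) *\<^sub>R v) = \<mu> *\<^sub>R ((1 / norm v) *\<^sub>R v)"
    by (simp add: matrix_vector_mult_scaleR del: transpose_matrix_vector)
  then show thesis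
    by (rule that[rotated]) (use v in simp)
qed

lemma classified_abelian: "classified (ext 0 M)"
proof -
  obtain v \<mu> where v: "norm v = 1" "transpose M *v v = \<mu> *\<^sub>R v"
    by (rule left_eigenvector_real_3)
  obtain f where f: "linear f" "\<And>x. f (f x) = x" "\<And>x y. f x \<bullet> f y = x \<bullet> y" "f v = axis 3 1"
    using householder[of v "axis 3 1"] v(1) by (metis norm_axis_1)
  define P where "P = matrix f"
  have P: "P *v x = f x" for x
    using f(1) by (simp add: P_def)
  have PP: "P ** P = mat 1"
    by (simp add: matrix_eq P f(2) flip: matrix_vector_mul_assoc)
  \<comment> \<open>As \<open>P\<close> takes \<open>v\<close> to \<open>e_3\<close>, the third row
    of \<open>M'\<close> is \<open>(0, 0, \<mu>)\<close>.\<close>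
  define M' where "M' = P ** M ** P"
  have third: "(M' *v x) $ 3 = \<mu> * x $ 3" for x
  proof -
    have "(M' *v x) $ 3 = f (M *v f x) \<bullet> f v"
      by (simp add: M'_def P f(4) inner_axis flip: matrix_vector_mul_assoc)
    also have "\<dots> = f x \<bullet> (transpose M *v v)"
      unfolding f(3) by (metis dot_lmul_matrix inner_commute transpose_matrix_vector)
    also have "\<dots> = \<mu> * (f x \<bullet> f (f v))"
      by (simp only: v f(2)) simp
    also have "\<dots> = \<mu> * x $ 3"
      unfolding f(3) by (simp add: f(4) inner_axis)
    finally show ?thesis .
  qed
  have "M' $ 3 $ j = (M' *v axis j 1) $ 3" for j
    by (simp add: matrix_vector_mult_basis column_def)
  then have row: "M' $ 3 $ 1 = 0" "M' $ 3 $ 2 = 0"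
    by (simp_all add: third) (simp_all add: axis_def)
  have "classified (ext 0 M')"
    by (subst mat3_eta) (simp add: row classified_abelian_block)
  moreover have "det P \<noteq> 0"
    using PP by (metis invertible_det_nz invertible_def)
  moreover have "P ** M' = 1 *\<^sub>R (M ** P)"
    by (simp add: M'_def matrix_mul_assoc PP)
  ultimately show ?thesis
    using classified_ext_abelian by (metis one_neq_zero)
qed

section \<open>Diagonalisation\<close>

lemma extensions_classified_congruence:
  fixes P :: "real^3^3"
  assumes "extensions_classified (cross_bracket S')" "transpose S' = S'"
    and "det P \<noteq> 0" "P ** S ** transpose P = det P *\<^sub>R S'"
  shows "extensions_classified (cross_bracket S)"
  using extensions_classified_isomorphic[OF lie_isomorphic_cross_bracket] lie_algebra_cross_bracket assms
  by blast

lemma transpose_diag3 [simp]: "transpose (diag3 a b c) = diag3 a b c"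
  by (simp add: diag3_def transpose_mat3)

text \<open>The sign makes \<open>P\<close> a rotation; a bare transposition would also negate the
  form.\<close>

lemma extensions_classified_diag_swap12:
  "extensions_classified (cross_bracket (diag3 b a c)) \<Longrightarrow> extensions_classified (cross_bracket (diag3 a b c))"
  by (erule extensions_classified_congruence[where P="mat3 0 (-1) 0 1 0 0 0 0 1"])
    (simp_all add: diag3_def mat3_simps)

lemma extensions_classified_diag_swap23:
  "extensions_classified (cross_bracket (diag3 a c b)) \<Longrightarrow> extensions_classified (cross_bracket (diag3 a b c))"
  by (erule extensions_classified_congruence[where P="mat3 1 0 0 0 0 (-1) 0 1 0"])
    (simp_all add: diag3_def mat3_simps)

lemma extensions_classified_diag_minus:
  "extensions_classified (cross_bracket (diag3 (-a) (-b) (-c))) \<Longrightarrow> extensions_classified (cross_bracket (diag3 a b c))"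
  by (erule extensions_classified_congruence[where P="diag3 (-1) (-1) (-1)"])
    (simp_all add: diag3_def mat3_simps)

lemma extensions_classified_diag_sgn:
  assumes "extensions_classified (cross_bracket (diag3 (2 * sgn a) (2 * sgn b) (2 * sgn c)))"
  shows "extensions_classified (cross_bracket (diag3 a b c))"
proof -
  define r where "r x = (if x = 0 then 1 else sqrt \<bar>x\<bar>)" for x :: real
  have r: "r x \<noteq> 0" "x / (r x * r x) = sgn x" for x
    by (auto simp: r_def sgn_if)
  \<comment> \<open>With this \<open>k\<close> the diagonal matrix has determinant
    \<open>k * k / 2\<close>, which cancels the factor 2 in the target.\<close>
  define k where "k = r a * r b * r c / 2"
  have k: "k \<noteq> 0" "2 * k = r a * r b * r c"
    using r by (simp_all add: k_def)
  have sq: "k / r x * x * (k / r x) = k * k * sgn x" for x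
    by (simp flip: r(2))
  have det: "k / r a * (k / r b) * (k / r c) * (2 * y) = k * k * y" for y
  proof -
    have "k / r a * (k / r b) * (k / r c) * (2 * y) = k * k * ((2 * k) / (r a * r b * r c)) * y"
      by simp
    also have "\<dots> = k * k * y"
      using r(1) by (simp add: k(2))
    finally show ?thesis .
  qed
  have eq: "diag3 x y z ** diag3 a b c ** transpose (diag3 x y z) = det (diag3 x y z) *\<^sub>R diag3 a' b' c'"
    if "x * a * x = x * y * z * a'" "y * b * y = x * y * z * b'" "z * c * z = x * y * z * c'" for x y z a' b' c'
    using that by (simp add: diag3_def mat3_simps)
  show ?thesis
    by (rule extensions_classified_congruence[where P="diag3 (k / r a) (k / r b) (k / r c)", OF assms _ _ eq])
      (simp, use r k in \<open>simp add: diag3_def det_mat3\<close>, simp_all only: det sq)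
qed

lemma extensions_classified_diag: "extensions_classified (cross_bracket (diag3 a b c))"
proof -
  let ?E = "\<lambda>a b c. extensions_classified (cross_bracket (diag3 a b c))"
  have base: "?E 2 2 2" "?E 2 2 (-2)" "?E 2 2 0" "?E 2 (-2) 0" "?E 2 0 0" "?E 0 0 0"
    using extensions_classified_rank3[of 1] extensions_classified_rank3[of "-1"]
      extensions_classified_rank2[of 1] extensions_classified_rank2[of "-1"] extensions_classified_heisenberg
    by (simp_all add: extensions_classifiedI classified_abelian diag3_def flip: zero_mat3)
  have minus: "?E (-2) (-2) (-2)" "?E (-2) (-2) 2" "?E (-2) (-2) 0" "?E (-2) 2 0" "?E (-2) 0 0"
    by (rule extensions_classified_diag_minus, simp add: base)+
  note swap12 = extensions_classified_diag_swap12
  note swap23 = extensions_classified_diag_swap23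
  \<comment> \<open>Up to permutation and a common sign, the 27 sign patterns reduce to the six in
    \<open>base\<close>.\<close>
  have "?E (2 * sgn a) (2 * sgn b) (2 * sgn c)"
    unfolding sgn_if
    using base minus base[THEN swap12] minus[THEN swap12] base[THEN swap23] minus[THEN swap23]
      base[THEN swap12, THEN swap23] minus[THEN swap12, THEN swap23]
      base[THEN swap23, THEN swap12] minus[THEN swap23, THEN swap12]
      base[THEN swap23, THEN swap12, THEN swap23] minus[THEN swap23, THEN swap12, THEN swap23]
    by auto
  then show ?thesis
    by (rule extensions_classified_diag_sgn)
qed

text \<open>For \<open>u = n \<times> x\<close> and \<open>v = n \<times> u\<close> the triple
  product is the squared norm of \<open>v\<close>.\<close>

lemma cross_span_independent:
  fixes n :: "real^3"
  assumes "n \<noteq> 0"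
  obtains u v where "n \<bullet> u = 0" "n \<bullet> v = 0" "n \<bullet> (u \<times> v) \<noteq> 0"
proof -
  obtain x where x: "n \<times> x \<noteq> 0"
    using cross_basis_nonzero[OF assms] by blast
  let ?u = "n \<times> x"
  have "n \<bullet> (?u \<times> (n \<times> ?u)) = (n \<times> ?u) \<bullet> (n \<times> ?u)"
    by (simp add: cross3_simps)
  also have "\<dots> = (n \<bullet> n) * (?u \<bullet> ?u)"
    using norm_and_cross_eq_0 norm_cross_dot[of n ?u]
    by (simp add: dot_cross_self power_mult_distrib power2_norm_eq_inner)
  finally have "n \<bullet> (?u \<times> (n \<times> ?u)) \<noteq> 0"
    using assms x by simp
  then show thesis
    by (rule that[rotated 2]) (simp_all add: dot_cross_self)
qed

text \<open>Lagrange's diagonalisation by completing squares, with cross products providing vectors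
  orthogonal to two given ones.\<close>

lemma symmetric_diagonal_basis:
  fixes S :: "real^3^3"
  assumes sym: "transpose S = S"
  obtains u v w where "u \<bullet> (S *v v) = 0" "u \<bullet> (S *v w) = 0" "v \<bullet> (S *v w) = 0" "u \<bullet> (v \<times> w) \<noteq> 0"
proof -
  have S: "x \<bullet> (S *v y) = (S *v x) \<bullet> y" "x \<bullet> (S *v y) = y \<bullet> (S *v x)" for x y
    using dot_lmul_matrix[of x S y] sym by (metis transpose_matrix_vector inner_commute)+
  have polar: "2 * (x \<bullet> (S *v y)) = (x + y) \<bullet> (S *v (x + y)) - x \<bullet> (S *v x) - y \<bullet> (S *v y)" for x y
    using S(2)[of x y] by (simp add: matrix_vector_right_distrib inner_add_left inner_add_right)
  show thesis
  proof (cases "\<exists>u. u \<bullet> (S *v u) \<noteq> 0")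
    case False
    then have "x \<bullet> (S *v y) = 0" for x y
      using polar[of x y] by simp
    then show thesis
      by (intro that[of "axis 1 1" "axis 2 1" "axis 3 1"]) (simp_all add: cross_basis inner_axis_axis)
  next
    case True
    then obtain u where u: "u \<bullet> (S *v u) \<noteq> 0"
      by blast
    define n where "n = S *v u"
    have n: "n \<noteq> 0"
      using u by (auto simp: n_def)
    have un: "u \<bullet> (S *v x) = n \<bullet> x" for x
      by (simp add: n_def S(1))
    show thesis
    proof (cases "\<exists>v. n \<bullet> v = 0 \<and> v \<bullet> (S *v v) \<noteq> 0")
      case True
      then obtain v where v: "n \<bullet> v = 0" "v \<bullet> (S *v v) \<noteq> 0"
        by blast
      \<comment> \<open>Being orthogonal to \<open>S *v u\<close> and \<open>S *v v\<close>,
        \<open>w\<close> is orthogonal to \<open>u\<close> and \<open>v\<close> for the form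
        \<open>S\<close>.\<close>
      define w where "w = n \<times> (S *v v)"
      have "u \<bullet> (v \<times> w) = (n \<bullet> u) * (v \<bullet> (S *v v)) - (n \<bullet> v) * (u \<bullet> (S *v v))"
        unfolding w_def by (simp add: cross3_simps)
      then have "u \<bullet> (v \<times> w) \<noteq> 0"
        using u v by (simp add: n_def inner_commute)
      moreover have "v \<bullet> (S *v w) = 0"
        by (simp add: S(1) w_def dot_cross_self)
      ultimately show thesis
        using v by (intro that[of u v w]) (simp_all add: un w_def dot_cross_self)
    next
      case False
      \<comment> \<open>The form vanishes on the plane orthogonal to \<open>n\<close>, so any basis
        of that plane completes \<open>u\<close>.\<close>
      obtain v w where vw: "n \<bullet> v = 0" "n \<bullet> w = 0" "n \<bullet> (v \<times> w) \<noteq> 0"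
        by (rule cross_span_independent[OF n])
      have "v \<bullet> (S *v w) = 0"
        using False polar[of v w] vw by (simp add: inner_add_right)
      moreover have "u \<bullet> (v \<times> w) \<noteq> 0"
      proof -
        have "(n \<bullet> u) * (n \<bullet> (v \<times> w)) = (n \<bullet> n) * (u \<bullet> (v \<times> w)) + (n \<bullet> v) * (n \<bullet> (u \<times> w)) - (n \<bullet> w) * (n \<bullet> (u \<times> v))"
          by (simp add: cross3_simps)
        then show ?thesis
          using vw u by (auto simp: n_def inner_commute)
      qed
      ultimately show thesis
        using vw by (intro that[of u v w]) (simp_all add: un)
    qed
  qed
qed

lemma extensions_classified_symmetric:
  assumes "transpose S = S"
  shows "extensions_classified (cross_bracket S)"
proof -
  obtain u v w where uvw: "u \<bullet> (S *v v) = 0" "u \<bullet> (S *v w) = 0" "v \<bullet> (S *v w) = 0" "u \<bullet> (v \<times> w) \<noteq> 0"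
    by (rule symmetric_diagonal_basis[OF assms])
  have S: "x \<bullet> (S *v y) = y \<bullet> (S *v x)" for x y
    using dot_lmul_matrix[of x S y] assms by (metis transpose_matrix_vector inner_commute)
  define P :: "real^3^3" where "P = vector [u, v, w]"
  have det: "det P = u \<bullet> (v \<times> w)"
    by (simp add: P_def dot_cross_det)
  \<comment> \<open>The rows of \<open>P\<close> are the basis, so the congruence yields its Gram
    matrix.\<close>
  have "(P ** S ** transpose P) $ i $ j = P $ i \<bullet> (S *v P $ j)" for i j
    by (simp add: matrix_matrix_mult_def matrix_vector_mult_def inner_vec_def transpose_def sum_3 algebra_simps)
  then have "P ** S ** transpose P = diag3 (u \<bullet> (S *v u)) (v \<bullet> (S *v v)) (w \<bullet> (S *v w))"
    using uvw S by (simp add: vec_eq_iff forall_3 diag3_def mat3_entries) (simp add: P_def S uvw)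
  then show ?thesis
    using uvw(4) by (intro extensions_classified_congruence[where P=P, OF extensions_classified_diag[of
            "(u \<bullet> (S *v u)) / det P" "(v \<bullet> (S *v v)) / det P" "(w \<bullet> (S *v w)) / det P"]])
      (simp_all add: det diag3_def scaleR_mat3 transpose_mat3)
qed

section \<open>A unimodular ideal of codimension one\<close>

definition linear_trace :: "('a::euclidean_space \<Rightarrow> 'a) \<Rightarrow> real" where
  "linear_trace f = (\<Sum>b\<in>Basis. f b \<bullet> b)"

text \<open>Both sides are the same double sum. It gives traceless commutators and invariance under
  conjugation.\<close>

lemma linear_trace_commute:
  fixes g :: "'a::euclidean_space \<Rightarrow> 'b::euclidean_space" and h :: "'b \<Rightarrow> 'a"
  assumes "linear g" "linear h"
  shows "linear_trace (\<lambda>x. g (h x)) = linear_trace (\<lambda>x. h (g x))"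
proof -
  have expand: "k (l b) \<bullet> b = (\<Sum>a\<in>Basis. (l b \<bullet> a) * (k a \<bullet> b))"
    if "linear k" for k :: "'c::euclidean_space \<Rightarrow> 'd::euclidean_space" and l :: "'d \<Rightarrow> 'c" and b
  proof -
    have "k (l b) = k (\<Sum>a\<in>Basis. (l b \<bullet> a) *\<^sub>R a)"
      by (simp add: euclidean_representation)
    then show ?thesis
      by (simp add: linear_sum[OF that] linear_scale[OF that] inner_sum_left)
  qed
  have "linear_trace (\<lambda>x. g (h x)) = (\<Sum>b\<in>Basis. \<Sum>a\<in>Basis. (h b \<bullet> a) * (g a \<bullet> b))"
    unfolding linear_trace_def by (intro sum.cong expand assms refl)
  also have "\<dots> = (\<Sum>a\<in>Basis. \<Sum>b\<in>Basis. (g a \<bullet> b) * (h b \<bullet> a))"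
    by (subst sum.swap) (simp add: mult.commute)
  also have "\<dots> = linear_trace (\<lambda>x. h (g x))"
    unfolding linear_trace_def by (intro sum.cong expand[symmetric] assms refl)
  finally show ?thesis .
qed

text \<open>By Jacobi, \<open>br (br x y)\<close> is the commutator of \<open>br x\<close> and
  \<open>br y\<close>.\<close>

lemma linear_trace_bracket:
  fixes br :: "'a::euclidean_space \<Rightarrow> 'a \<Rightarrow> 'a"
  assumes "lie_algebra br"
  shows "linear_trace (br (br x y)) = 0"
proof -
  have bil: "bilinear br" and alt: "\<And>x. br x x = 0"
    and jac: "\<And>x y z. br x (br y z) + br y (br z x) + br z (br x y) = 0"
    using assms by (auto simp: lie_algebra_def)
  note anti = bilinear_alternating_skew[OF bil alt]
  have "br (br x y) z = br x (br y z) - br y (br x z)" for z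
    using jac[of x y z] anti[of z x] anti[of z "br x y"]
    by (simp add: bilinear_rneg[OF bil] eq_neg_iff_add_eq_0 algebra_simps)
  then have "linear_trace (br (br x y)) = linear_trace (\<lambda>z. br x (br y z)) - linear_trace (\<lambda>z. br y (br x z))"
    by (simp add: linear_trace_def inner_diff_left sum_subtractf)
  moreover have "linear (br x)" "linear (br y)"
    using bil by (simp_all add: bilinear_def)
  ultimately show ?thesis
    using linear_trace_commute[of "br x" "br y"] by simp
qed

lemma linear_trace_prod_real:
  fixes f :: "(real^3) \<times> real \<Rightarrow> (real^3) \<times> real"
  shows "linear_trace f = fst (f (axis 1 1, 0)) $ 1 + fst (f (axis 2 1, 0)) $ 2 + fst (f (axis 3 1, 0)) $ 3
    + snd (f (0, 1))"
proof -
  have "(Basis :: (real^3) set) = {axis 1 1, axis 2 1, axis 3 1}"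
    by (auto simp: Basis_vec_def UNIV_3)
  then have B: "(Basis :: ((real^3) \<times> real) set) = {(axis 1 1, 0), (axis 2 1, 0), (axis 3 1, 0), (0, 1)}"
    by (auto simp: Basis_prod_def)
  then show ?thesis
    unfolding linear_trace_def B by (simp add: inner_prod_def inner_axis axis_eq_axis)
qed

text \<open>An alternating bilinear map factors through the exterior square, where
  \<open>x \<times> y\<close> gives the coordinates on \<open>e_i \<and> e_j\<close> and
  \<open>t *\<^sub>R x - s *\<^sub>R y\<close> those on \<open>e_i \<and> e\<close>.\<close>

lemma bracket_coordinates:
  fixes br :: "(real^3) \<times> real \<Rightarrow> (real^3) \<times> real \<Rightarrow> (real^3) \<times> real"
  assumes bil: "bilinear br" and alt: "\<And>x. br x x = 0"
  obtains A D a d where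
    "\<And>x s y t. br (x, s) (y, t) =
      (A *v (x \<times> y) + D *v (t *\<^sub>R x - s *\<^sub>R y), a \<bullet> (x \<times> y) + d \<bullet> (t *\<^sub>R x - s *\<^sub>R y))"
proof -
  note anti = bilinear_alternating_skew[OF bil alt]
  define u where "u i = (axis i 1 :: real^3, 0 :: real)" for i
  define v where "v = (0 :: real^3, 1 :: real)"
  define F where "F z = z $ 1 *\<^sub>R br (u 2) (u 3) + z $ 2 *\<^sub>R br (u 3) (u 1) + z $ 3 *\<^sub>R br (u 1) (u 2)"
    for z :: "real^3"
  define G where "G z = br (z, 0) v" for z
  have expand: "(x, s) = x $ 1 *\<^sub>R u 1 + x $ 2 *\<^sub>R u 2 + x $ 3 *\<^sub>R u 3 + s *\<^sub>R v" for x s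
    by (simp add: u_def v_def vec_eq_iff forall_3 axis_def)
  have G: "G z = z $ 1 *\<^sub>R br (u 1) v + z $ 2 *\<^sub>R br (u 2) v + z $ 3 *\<^sub>R br (u 3) v" for z
    unfolding G_def by (subst expand) (simp add: bilinear_ladd[OF bil] bilinear_lmul[OF bil])
  have br: "br (x, s) (y, t) = F (x \<times> y) + G (t *\<^sub>R x - s *\<^sub>R y)" for x s y t
    unfolding G by (subst expand[of x], subst expand[of y])
      (simp add: F_def cross_components bilinear_ladd[OF bil] bilinear_lmul[OF bil]
        bilinear_radd[OF bil] bilinear_rmul[OF bil] alt anti[of "u 2" "u 1"] anti[of "u 3" "u 2"]
        anti[of "u 1" "u 3"] anti[of v] algebra_simps)
  have "linear F" "linear G"
    unfolding G[abs_def] F_def[abs_def] by (auto intro!: linearI simp: algebra_simps)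
  then have lin: "linear (\<lambda>z. fst (F z))" "linear (\<lambda>z. snd (F z))" "linear (\<lambda>z. fst (G z))" "linear (\<lambda>z. snd (G z))"
    by (simp_all add: linear_iff)
  have rep: "l z = adjoint l 1 \<bullet> z" if "linear l" for l :: "real^3 \<Rightarrow> real" and z
    using adjoint_works[OF that, of z 1] by (simp add: inner_commute)
  show thesis
    by (rule that[of "matrix (\<lambda>z. fst (F z))" "matrix (\<lambda>z. fst (G z))" "adjoint (\<lambda>z. snd (F z)) 1"
          "adjoint (\<lambda>z. snd (G z)) 1"])
      (simp add: br prod_eq_iff matrix_works lin flip: rep)
qed

text \<open>Let \<open>\<delta>\<close> be the Chevalley--Eilenberg differential, so that \<open>\<delta>\<nu>\<close> is, up to sign, the two-form
  \<open>\<nu> (br x y)\<close>. For \<open>\<nu> = (n, m)\<close> the two factors below are the coordinates of \<open>\<delta>\<nu>\<close> on the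
  \<open>e\<^sub>i \<and> e\<^sub>j\<close> and on the \<open>e\<^sub>i \<and> e\<close>, so the claim is \<open>\<delta>\<nu> \<and> \<delta>\<nu> = 0\<close>. This holds since
  \<open>\<delta>\<nu> \<and> \<delta>\<nu> = \<delta>(\<nu> \<and> \<delta>\<nu>)\<close> and \<open>\<delta>\<close> vanishes on three-forms of a unimodular algebra.\<close>

lemma unimodular_isotropic:
  fixes br :: "(real^3) \<times> real \<Rightarrow> (real^3) \<times> real \<Rightarrow> (real^3) \<times> real"
  assumes lie: "lie_algebra br" and uni: "\<And>x. linear_trace (br x) = 0"
    and br: "\<And>x s y t. br (x, s) (y, t) =
      (A *v (x \<times> y) + D *v (t *\<^sub>R x - s *\<^sub>R y), a \<bullet> (x \<times> y) + d \<bullet> (t *\<^sub>R x - s *\<^sub>R y))"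
  shows "(transpose A *v n + m *\<^sub>R a) \<bullet> (transpose D *v n + m *\<^sub>R d) = 0"
proof -
  obtain b11 b12 b13 b21 b22 b23 b31 b32 b33 where A: "A = mat3 b11 b12 b13 b21 b22 b23 b31 b32 b33"
    using mat3_eta by blast
  obtain c11 c12 c13 c21 c22 c23 c31 c32 c33 where D: "D = mat3 c11 c12 c13 c21 c22 c23 c31 c32 c33"
    using mat3_eta by blast
  have eta: "v = vector [v $ 1, v $ 2, v $ 3]" for v :: "real^3"
    by (simp add: vec_eq_iff forall_3)
  obtain a1 a2 a3 where a: "a = vector [a1, a2, a3]"
    using eta by blast
  obtain d1 d2 d3 where d: "d = vector [d1, d2, d3]"
    using eta by blast
  obtain n1 n2 n3 where n: "n = vector [n1, n2, n3]"
    using eta by blast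
  have e: "(axis 1 1 :: real^3) = vector [1, 0, 0]" "(axis 2 1 :: real^3) = vector [0, 1, 0]"
    "(axis 3 1 :: real^3) = vector [0, 0, 1]"
    by (simp_all add: vec_eq_iff forall_3 axis_def)
  note eval = br A D a d e mat3_vector_mult cross3_def inner_vec_def sum_3
  \<comment> \<open>Unimodularity fixes the antisymmetric part of \<open>A\<close> in terms of
    \<open>d\<close> and makes \<open>D\<close> traceless.\<close>
  have "b32 = b23 + d1" "b13 = b31 + d2" "b21 = b12 + d3" "c33 = - c11 - c22"
    using uni[of "(axis 1 1, 0)"] uni[of "(axis 2 1, 0)"] uni[of "(axis 3 1, 0)"] uni[of "(0, 1)"]
    unfolding linear_trace_prod_real by (simp_all add: eval algebra_simps)
  then have A': "A = mat3 b11 b12 (b31 + d2) (b12 + d3) b22 b23 b31 (b23 + d1) b33"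
    and D': "D = mat3 c11 c12 c13 c21 c22 c23 c31 c32 (- c11 - c22)"
    by (simp_all add: A D)
  have ev: "br (vector [x1, x2, x3], s) (vector [y1, y2, y3], t) =
    (let u1 = x2 * y3 - x3 * y2; u2 = x3 * y1 - x1 * y3; u3 = x1 * y2 - x2 * y1;
         v1 = t * x1 - s * y1; v2 = t * x2 - s * y2; v3 = t * x3 - s * y3
     in (vector [b11 * u1 + b12 * u2 + (b31 + d2) * u3 + c11 * v1 + c12 * v2 + c13 * v3,
          (b12 + d3) * u1 + b22 * u2 + b23 * u3 + c21 * v1 + c22 * v2 + c23 * v3,
          b31 * u1 + (b23 + d1) * u2 + b33 * u3 + c31 * v1 + c32 * v2 + (- c11 - c22) * v3],
         a1 * u1 + a2 * u2 + a3 * u3 + d1 * v1 + d2 * v2 + d3 * v3))"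
    for x1 x2 x3 s y1 y2 y3 t
    by (simp add: Let_def br A' D' a d mat3_vector_mult cross3_def inner_vec_def sum_3 vec_eq_iff forall_3)
  have zero: "(vector [p, q, r] :: real^3, s) + (vector [p', q', r'], s') + (vector [p'', q'', r''], s'') = 0 \<longleftrightarrow>
     p + p' + p'' = 0 \<and> q + q' + q'' = 0 \<and> r + r' + r'' = 0 \<and> s + s' + s'' = 0"
    for p q r s p' q' r' s' p'' q'' r'' s'' :: real
    by (simp add: prod_eq_iff vec_eq_iff forall_3)
  have jac: "br x (br y z) + br y (br z x) + br z (br x y) = 0" for x y z
    using lie unfolding lie_algebra_def by blast
  note simps = ev Let_def zero mult_zero_left mult_zero_right mult_1_left mult_1_right diff_0 diff_0_right
    add_0_left add_0_right
  let ?e1 = "(vector [1, 0, 0], 0) :: (real^3) \<times> real" and ?e2 = "(vector [0, 1, 0], 0) :: (real^3) \<times> real"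
    and ?e3 = "(vector [0, 0, 1], 0) :: (real^3) \<times> real" and ?e4 = "(vector [0, 0, 0], 1) :: (real^3) \<times> real"
  note J = jac[of ?e1 ?e2 ?e3, unfolded simps] jac[of ?e1 ?e2 ?e4, unfolded simps]
   jac[of ?e2 ?e3 ?e4, unfolded simps] jac[of ?e3 ?e1 ?e4, unfolded simps]
  \<comment> \<open>The ten coefficients of the quadratic form in \<open>n1\<close>,
    \<open>n2\<close>, \<open>n3\<close>, \<open>m\<close>, each a linear consequence of Jacobi on
    the four triples of basis vectors.\<close>
  have Q:
    "b11 * c11 + b12 * c12 + (b31 + d2) * c13 = 0"
    "b11 * c21 + b12 * c22 + (b31 + d2) * c23 + (b12 + d3) * c11 + b22 * c12 + b23 * c13 = 0"
    "b11 * c31 + b12 * c32 + (b31 + d2) * (- c11 - c22) + b31 * c11 + (b23 + d1) * c12 + b33 * c13 = 0"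
    "b11 * d1 + b12 * d2 + (b31 + d2) * d3 + a1 * c11 + a2 * c12 + a3 * c13 = 0"
    "(b12 + d3) * c21 + b22 * c22 + b23 * c23 = 0"
    "(b12 + d3) * c31 + b22 * c32 + b23 * (- c11 - c22) + b31 * c21 + (b23 + d1) * c22 + b33 * c23 = 0"
    "(b12 + d3) * d1 + b22 * d2 + b23 * d3 + a1 * c21 + a2 * c22 + a3 * c23 = 0"
    "b31 * c31 + (b23 + d1) * c32 + b33 * (- c11 - c22) = 0"
    "b31 * d1 + (b23 + d1) * d2 + b33 * d3 + a1 * c31 + a2 * c32 + a3 * (- c11 - c22) = 0"
    "a1 * d1 + a2 * d2 + a3 * d3 = 0"
    by (insert J, elim conjE, simp_all only: algebra_simps minus_mult_left[symmetric]
        minus_mult_right[symmetric] mult_1_right minus_minus) (linarith+)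
  have "(transpose A *v n + m *\<^sub>R a) \<bullet> (transpose D *v n + m *\<^sub>R d) =
    n1 * n1 * (b11 * c11 + b12 * c12 + (b31 + d2) * c13) +
    n1 * n2 * (b11 * c21 + b12 * c22 + (b31 + d2) * c23 + (b12 + d3) * c11 + b22 * c12 + b23 * c13) +
    n1 * n3 * (b11 * c31 + b12 * c32 + (b31 + d2) * (- c11 - c22) + b31 * c11 + (b23 + d1) * c12 + b33 * c13) +
    n1 * m * (b11 * d1 + b12 * d2 + (b31 + d2) * d3 + a1 * c11 + a2 * c12 + a3 * c13) +
    n2 * n2 * ((b12 + d3) * c21 + b22 * c22 + b23 * c23) +
    n2 * n3 * ((b12 + d3) * c31 + b22 * c32 + b23 * (- c11 - c22) + b31 * c21 + (b23 + d1) * c22 + b33 * c23) +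
    n2 * m * ((b12 + d3) * d1 + b22 * d2 + b23 * d3 + a1 * c21 + a2 * c22 + a3 * c23) +
    n3 * n3 * (b31 * c31 + (b23 + d1) * c32 + b33 * (- c11 - c22)) +
    n3 * m * (b31 * d1 + (b23 + d1) * d2 + b33 * d3 + a1 * c31 + a2 * c32 + a3 * (- c11 - c22)) +
    m * m * (a1 * d1 + a2 * d2 + a3 * d3)"
    by (simp add: A' D' a d n transpose_mat3 mat3_vector_mult inner_vec_def sum_3 algebra_simps del: transpose_matrix_vector)
  then show ?thesis
    unfolding Q by simp
qed

lemma exists_orthogonal_to_brackets:
  fixes br :: "(real^3) \<times> real \<Rightarrow> (real^3) \<times> real \<Rightarrow> (real^3) \<times> real"
  assumes lie: "lie_algebra br"
  obtains n where "n \<noteq> 0" "\<And>x y. n \<bullet> br x y = 0" "\<And>x. n \<bullet> x = 0 \<Longrightarrow> linear_trace (br x) = 0"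
proof (cases "\<forall>x. linear_trace (br x) = 0")
  case False
  have bil: "bilinear br"
    using lie by (simp add: lie_algebra_def)
  have "linear (\<lambda>x. linear_trace (br x))"
    by (rule linearI) (simp_all add: linear_trace_def bilinear_ladd[OF bil] bilinear_lmul[OF bil]
        inner_add_left sum.distrib sum_distrib_left)
  from adjoint_works[OF this, of _ 1]
  have n: "adjoint (\<lambda>x. linear_trace (br x)) 1 \<bullet> x = linear_trace (br x)" for x
    by (simp add: inner_commute)
  show thesis
  proof (rule that[of "adjoint (\<lambda>x. linear_trace (br x)) 1"])
    show "adjoint (\<lambda>x. linear_trace (br x)) 1 \<noteq> 0"
      using False n by (metis inner_zero_left)
  qed (simp_all add: n linear_trace_bracket[OF lie])
next
  case True
  obtain A D a d where br: "\<And>x s y t. br (x, s) (y, t) =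
      (A *v (x \<times> y) + D *v (t *\<^sub>R x - s *\<^sub>R y), a \<bullet> (x \<times> y) + d \<bullet> (t *\<^sub>R x - s *\<^sub>R y))"
    using bracket_coordinates lie unfolding lie_algebra_def by metis
  \<comment> \<open>\<open>L\<close> sends \<open>\<nu> = (n, m)\<close> to the coordinates of the
    two-form \<open>\<nu>\<close> composed with \<open>br\<close>.\<close>
  define L where "L = (\<lambda>(n, m). (transpose A *v n + m *\<^sub>R a, transpose D *v n + m *\<^sub>R d))"
  have L: "linear L"
    by (rule linearI) (auto simp: L_def matrix_vector_right_distrib matrix_vector_mult_scaleR algebra_simps
        simp del: transpose_matrix_vector)
  have iso: "fst (L p) \<bullet> snd (L p) = 0" for p
    using unimodular_isotropic[OF lie True[rule_format] br] by (cases p) (simp add: L_def del: transpose_matrix_vector)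
  have polar: "fst (L p) \<bullet> snd (L q) + snd (L p) \<bullet> fst (L q) = 0" for p q
    using iso[of "p + q"] iso[of p] iso[of q]
    by (simp add: linear_add[OF L] inner_add_left inner_add_right inner_commute)
  have "\<not> inj L"
  proof
    assume inj: "inj L"
    have swap: "linear (\<lambda>x. (snd x, fst x) :: (real^3) \<times> (real^3))" "inj (\<lambda>x. (snd x, fst x) :: (real^3) \<times> (real^3))"
      by (auto intro!: linearI injI simp: prod_eq_iff)
    let ?U = "range L"
    let ?V = "(\<lambda>x. (snd x, fst x)) ` ?U"
    have dims: "dim ?U = 4" "dim ?V = 4"
      using dim_image_eq[OF L inj_on_subset[OF inj]] dim_image_eq[OF swap(1) inj_on_subset[OF swap(2)], of ?U] by simp_all
    \<comment> \<open>By isotropy \<open>range L\<close> is orthogonal to its image under exchanging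
      the factors. Two orthogonal spaces of dimension 4 do not fit into dimension 6.\<close>
    have "dim ?V \<le> dim {y \<in> UNIV. \<forall>x\<in>?U. orthogonal x y}"
      using polar by (intro dim_subset) (auto simp: orthogonal_def inner_prod_def inner_commute add.commute)
    moreover have "dim {y \<in> UNIV. \<forall>x\<in>?U. orthogonal x y} + dim ?U = dim (UNIV :: ((real^3) \<times> (real^3)) set)"
      by (rule dim_subspace_orthogonal_to_vectors) (auto intro: linear_subspace_image L)
    ultimately show False
      using dims by simp
  qed
  then obtain p where p: "p \<noteq> 0" "L p = 0"
    using linear_injective_0[OF L] by blast
  show thesis
  proof (rule that[OF p(1)])
    obtain n m where nm: "p = (n, m)"
      by (cases p)
    have L0: "transpose A *v n + m *\<^sub>R a = 0" "transpose D *v n + m *\<^sub>R d = 0"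
      using p(2) by (simp_all add: L_def nm zero_prod_def del: transpose_matrix_vector)
    have *: "n \<bullet> (B *v z) + m * (b \<bullet> z) = (transpose B *v n + m *\<^sub>R b) \<bullet> z" for B :: "real^3^3" and b z
      by (simp add: inner_add_left dot_lmul_matrix)
    show "p \<bullet> br x y = 0" for x y
    proof -
      obtain x' s y' t where "x = (x', s)" "y = (y', t)"
        by (metis surj_pair)
      then have "p \<bullet> br x y = (n \<bullet> (A *v (x' \<times> y')) + m * (a \<bullet> (x' \<times> y')))
          + (n \<bullet> (D *v (t *\<^sub>R x' - s *\<^sub>R y')) + m * (d \<bullet> (t *\<^sub>R x' - s *\<^sub>R y')))"
        by (simp add: nm br inner_prod_def inner_add_right algebra_simps)
      then show ?thesis
        unfolding * L0 by simp
    qed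
  qed (simp add: True)
qed

text \<open>The Leibniz rule is the Jacobi identity for \<open>x\<close>, \<open>y\<close> and
  \<open>e\<close>.\<close>

lemma derivation_if_lie_algebra_D_extension:
  assumes lie: "lie_algebra (D_extension br D)" and "bilinear br" "linear D" "\<And>x. br x x = 0"
  shows "derivation br D"
proof -
  have "D (br x y) = br (D x) y + br x (D y)" for x y
  proof -
    let ?E = "D_extension br D"
    have "?E (x, 0) (?E (y, 0) (0, 1)) + ?E (y, 0) (?E (0, 1) (x, 0)) + ?E (0, 1) (?E (x, 0) (y, 0)) = 0"
      using lie by (simp add: lie_algebra_def)
    then have "br x (D y) - br y (D x) - D (br x y) = 0"
      using assms(2,3) by (simp add: D_extension_def zero_prod_def linear_0 bilinear_rneg bilinear_rzero bilinear_lzero)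
    then show ?thesis
      using bilinear_alternating_skew[OF assms(2,4), of y "D x"] by (simp add: algebra_simps)
  qed
  then show ?thesis
    using assms(3) by (simp add: derivation_def)
qed

lemma classified_prod_real:
  fixes br :: "(real^3) \<times> real \<Rightarrow> (real^3) \<times> real \<Rightarrow> (real^3) \<times> real"
  assumes lie: "lie_algebra br"
  shows "classified br"
proof -
  obtain n where n: "n \<noteq> 0" "\<And>x y. n \<bullet> br x y = 0" "\<And>x. n \<bullet> x = 0 \<Longrightarrow> linear_trace (br x) = 0"
    using exists_orthogonal_to_brackets[OF lie] by blast
  have norm: "norm n = norm (0 :: real^3, norm n)"
    by (simp add: norm_Pair)
  \<comment> \<open>The reflection makes the hyperplane orthogonal to \<open>n\<close> the factor
    \<open>real^3\<close>, which then contains all brackets.\<close>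
  obtain f where f: "linear f" "\<And>x. f (f x) = x" "\<And>x y. f x \<bullet> f y = x \<bullet> y" "f n = (0, norm n)"
    using householder[OF norm] by metis
  have bij: "bij f"
    by (rule o_bij[of f]) (simp_all add: fun_eq_iff f(2) del: split_paired_All)
  have inv: "inv f = f"
    using f(2) by (intro inv_equality)
  define br' where "br' x y = f (br (f x) (f y))" for x y
  have br': "lie_algebra br'" "lie_isomorphic br br'"
    using lie_algebra_transport[OF lie f(1) bij] unfolding br'_def[abs_def] inv by simp_all
  have snd: "snd (br' x y) = 0" for x y
  proof -
    have "norm n * snd (br' x y) = f n \<bullet> br' x y"
      by (simp add: f(4) inner_prod_def)
    also have "\<dots> = 0"
      by (simp add: br'_def f(3) n(2))
    finally show ?thesis
      using n(1) by simp
  qed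
  have trace: "linear_trace (br' (x, 0)) = 0" for x
  proof -
    have lin: "linear (\<lambda>z. br (f (x, 0)) (f z))"
      using lie f(1) linear_compose[of f "br (f (x, 0))"]
      unfolding lie_algebra_def bilinear_def o_def by blast
    have "linear_trace (br' (x, 0)) = linear_trace (br (f (x, 0)))"
      unfolding br'_def using linear_trace_commute[OF f(1) lin] by (simp add: f(2))
    moreover have "n \<bullet> f (x, 0) = f n \<bullet> (x, 0)"
      using f(3)[of n "f (x, 0)"] by (simp add: f(2))
    ultimately show ?thesis
      using n(3) by (simp add: f(4) inner_prod_def)
  qed
  obtain A D a d where coord: "\<And>x s y t. br' (x, s) (y, t) =
      (A *v (x \<times> y) + D *v (t *\<^sub>R x - s *\<^sub>R y), a \<bullet> (x \<times> y) + d \<bullet> (t *\<^sub>R x - s *\<^sub>R y))"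
    using bracket_coordinates br' unfolding lie_algebra_def by metis
  have ext: "br' = ext A D"
  proof (intro ext)
    fix x y
    show "br' x y = ext A D x y"
      using snd[of x y] by (cases x, cases y) (simp add: coord D_extension_def cross_bracket_def
          matrix_vector_mult_diff_distrib matrix_vector_mult_scaleR)
  qed
  have "transpose A = A"
  proof -
    obtain a11 a12 a13 a21 a22 a23 a31 a32 a33 where A: "A = mat3 a11 a12 a13 a21 a22 a23 a31 a32 a33"
      using mat3_eta by blast
    \<comment> \<open>The trace of the adjoint map of \<open>e_i\<close> is the difference of two
      opposite entries of \<open>A\<close>.\<close>
    have "a12 = a21" "a13 = a31" "a23 = a32"
      using trace[of "axis 1 1"] trace[of "axis 2 1"] trace[of "axis 3 1"]
      unfolding ext linear_trace_prod_real
      by (simp_all add: A D_extension_def cross_bracket_def mat3_vector_mult cross_basis cross_components axis_def)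
    then show ?thesis
      by (simp add: A transpose_mat3)
  qed
  moreover have "derivation (cross_bracket A) ((*v) D)"
    by (intro derivation_if_lie_algebra_D_extension br'(1)[unfolded ext] bilinear_cross_bracket
        matrix_vector_mul_linear cross_bracket_self)
  ultimately have "classified br'"
    using extensions_classified_symmetric unfolding ext extensions_classified_def by blast
  then show ?thesis
    using br'(2) classified_isomorphic by blast
qed

section \<open>Passage to an arbitrary four-dimensional space\<close>

lemma exists_linear_bij_prod_real:
  assumes "dim (UNIV :: 'a::real_vector set) = 4"
  obtains \<phi> :: "'a::real_vector \<Rightarrow> (real^3) \<times> real" where "linear \<phi>" "bij \<phi>"
proof -
  obtain B :: "'a set" where B: "independent B" "span B = UNIV" "card B = 4"
    using basis_exists[of "UNIV :: 'a set"] assms by (metis top.extremum_uniqueI)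
  \<comment> \<open>Infinite sets have cardinality 0, so \<open>card B = 4\<close> yields
    finiteness.\<close>
  have "finite B" "card B = card (Basis :: ((real^3) \<times> real) set)"
    using B(3) card.infinite[of B] by fastforce+
  then obtain g where g: "bij_betw g B (Basis :: ((real^3) \<times> real) set)"
    using finite_same_card_bij finite_Basis by blast
  obtain \<phi> where \<phi>: "linear \<phi>" "\<forall>x\<in>B. \<phi> x = g x"
    using linear_independent_extend[OF B(1)] by blast
  obtain \<psi> where \<psi>: "linear \<psi>" "\<forall>x\<in>Basis. \<psi> x = inv_into B g x"
    using linear_independent_extend[OF independent_Basis] by blast
  have "(\<psi> \<circ> \<phi>) x = id x" for x
  proof (rule linear_eq_on_span[of "\<psi> \<circ> \<phi>" id B x])
    show "(\<psi> \<circ> \<phi>) b = id b" if "b \<in> B" for b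
      using that g \<phi>(2) \<psi>(2) by (simp add: bij_betw_apply bij_betw_inv_into_left)
  qed (use B \<phi> \<psi> in \<open>auto intro: linear_compose simp: linear_id\<close>)
  moreover have "(\<phi> \<circ> \<psi>) x = id x" for x
  proof (rule linear_eq_on_span[of "\<phi> \<circ> \<psi>" id Basis x])
    show "(\<phi> \<circ> \<psi>) b = id b" if "b \<in> Basis" for b
      using that g \<phi>(2) \<psi>(2) bij_betwE[OF bij_betw_inv_into[OF g]] by (simp add: bij_betw_inv_into_right)
  qed (use \<phi> \<psi> in \<open>auto intro: linear_compose simp: linear_id\<close>)
  ultimately have "bij \<phi>"
    by (intro o_bij[of \<psi>]) (auto simp: fun_eq_iff)
  with \<phi>(1) show thesis
    by (rule that)
qed

theorem theorem5p2:
  fixes br :: "'a::real_vector \<Rightarrow> 'a \<Rightarrow> 'a"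
  assumes "lie_algebra br" and "dim (UNIV :: 'a set) = 4"
  shows "\<exists>f D. listed f D \<and> unimodular (lie_of f) \<and> derivation (lie_of f) ((*v) D) \<and>
           lie_isomorphic br (D_extension (lie_of f) ((*v) D))"
proof -
  obtain \<phi> :: "'a \<Rightarrow> (real^3) \<times> real" where \<phi>: "linear \<phi>" "bij \<phi>"
    using exists_linear_bij_prod_real[OF assms(2)] .
  have "classified br"
    by (rule classified_isomorphic[OF lie_algebra_transport(2) classified_prod_real[OF lie_algebra_transport(1)]])
      (fact assms(1) \<phi>)+
  then obtain f M where f: "listed f M" "lie_isomorphic br (D_extension (lie_of f) ((*v) M))"
    unfolding classified_def by blast
  show ?thesis
    by (intro exI[of _ f] exI[of _ M] conjI f listed_imp[OF f(1)])
qed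

end
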